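(* Let $\mathbb{X}$ be a time scale, unbounded above, with $t_0\in\mathbb{X}$ and $\sigma(\rho(t))=\rho(\sigma(t))=t$ for all $t\in[t_0,\infty)_{\mathbb{X}}=[t_0,\infty)\cap\mathbb{X}$. Let $A=\begin{pmatrix} A_1 & 0 \\ 0 & A_2 \end{pmatrix}\ge0$ (Hermitian) and $B=\begin{pmatrix} B_1 & B_2 \\ B_3 & B_4 \end{pmatrix}$ have rd-continuous blocks $[t_0,\infty)_{\mathbb{X}}\to\mathbb{C}^{n,n}$, with $I_n+\mu(t)B_2(t)$ and $I_n+\mu(t)B_3(t)$ invertible for all $t\in[t_0,\infty)_{\mathbb{X}}$. Let $\mathscr{U}\in\mathbb{C}^{n,n}$ be invertible, $\mathscr{U}_{2n}=\begin{pmatrix} \mathscr{U} & 0_n \\ 0_n & -\mathscr{U}^* \end{pmatrix}$, and let $\lambda_0\in\mathbb{C}$ be such that $(\lambda_0,\mathscr{U}_{2n})$ is an admissible pair, i.e. $W(t,\lambda_0)\ge0$ for all $t\in[t_0,\infty)_{\mathbb{X}}$. Assume the definiteness condition: for every $\lambda\in\Lambda(\lambda_0,\mathscr{U}_{2n})$ and $\zeta\in\mathbb{C}^n$, if $W(t,\lambda)\phi(t,\lambda)\zeta=0$ for all $t\in[t_0,\infty)_{\mathbb{X}}$ then $\zeta=0$. Let $\lambda\in\Lambda(\lambda_0,\mathscr{U}_{2n})$ and $t_1=t_1(\lambda)$. Then, with $W$, $\Lambda(\lambda_0,\mathscr{U}_{2n})$, $\phi$, the Weyl-Sims sets $D(t,\lambda)$,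 the centers $\mathscr{C}(t,\lambda)$ and $t_1(\lambda)$ as defined in the context: (i) $D(t,\lambda)\subseteq D(\tau,\lambda)$ for $t,\tau\in[t_0,\infty)_{\mathbb{X}}$ with $t>\tau$; (ii) $D(t,\lambda)-\mathscr{C}(t,\lambda)\subseteq D(\tau,\lambda)-\mathscr{C}(\tau,\lambda)$ for $t,\tau\in[t_1,\infty)_{\mathbb{X}}$ with $t>\tau$; (iii) $D(t,\lambda)$ is compact and convex for $t\in[t_1,\infty)_{\mathbb{X}}$; (iv) $\mathscr{C}(\infty,\lambda):=\lim_{t\to\infty}\mathscr{C}(t,\lambda)$ exists; (v) $\bigcap_{t\in[t_1,\infty)_{\mathbb{X}}}\left[D(t,\lambda)-\mathscr{C}(t,\lambda)\right]=D(\infty,\lambda)-\mathscr{C}(\infty,\lambda)$, where $D(\infty,\lambda):=\bigcap_{t\in[t_1,\infty)_{\mathbb{X}}}D(t,\lambda)$; (vi) $\mathscr{C}(\infty,\lambda)\in D(\infty,\lambda)$.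
   Context: A time scale is a nonempty closed subset of $\mathbb{R}$; $\rho(t)=\sup\{s\in\mathbb{X}:s<t\}$, $\sigma(t)=\inf\{s\in\mathbb{X}:s>t\}$, $\mu(t)=\sigma(t)-t$; the delta derivative is $y^\Delta(t)=\lim_{s\to t}\frac{y(\sigma(t))-y(s)}{\sigma(t)-s}$; rd-continuous means continuous at right-dense points with finite left limits at left-dense points. For a square matrix $M$, $\mathrm{Re}[M]=\frac12(M+M^* )$; inequalities between Hermitian matrices are in the semidefinite (Loewner) order. $J=\begin{pmatrix} 0_n & -I_n \\ I_n & 0_n \end{pmatrix}$. For a set $D$ of matrices and a matrix $C$, $D-C=\{l-C:l\in D\}$. The underlying system is $J\widehat{y}^\Delta(t)=(\lambda A(t)+B(t))y(t)$ with $\widehat{y}=(y_1,y_2\circ\rho)^{\mathrm T}$; for solutions, $y=H\widehat{y}$ with $H=H(t,\lambda)=\begin{pmatrix} I_n & 0_n \\ -\mu E_2(\lambda A_1+B_1) & E_2 \end{pmatrix}$, $E_2=(I_n+\mu B_2)^{-1}$. Let $\widehat{Y}(t)=(\widehat{\theta}(t)\,|\,\widehat{\phi}(t))\in\mathbb{C}^{2n,2n}$ (with $\widehat\theta,\widehat\phi$ being $2n\times n$) be the unique solution of $J\widehat{Y}^\Delta=(\lambda A+B)H\widehat{Y}$, $\widehat{Y}(t_0)=J$, and put $\theta=H\widehat{\theta}$, $\phi=H\widehat{\phi}$ (all depending on $\lambda$). Set $W(t,\lambda)=\mathrm{Re}[\mathscr{U}_{2n}(\lambda A(t)+B(t))]$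 and $$\Lambda(\lambda_0,\mathscr{U}_{2n})=\{\lambda\in\mathbb{C}:\ \exists\,\delta>0\text{ with }\mathrm{Re}[(\lambda-\lambda_0)\mathscr{U}_{2n}A(t)]\ge\delta\,\mathscr{U}_{2n}A(t)\mathscr{U}_{2n}^*\ \ \forall t\in[t_0,\infty)_{\mathbb{X}}\}.$$ The Weyl-Sims sets are $$D(t,\lambda)=\{l\in\mathbb{C}^{n,n}:(\widehat\theta(t)+\widehat\phi(t)l)^*\,\mathscr{U}_{2n}J\,(\widehat\theta(t)+\widehat\phi(t)l)\le0\}.$$ The matrix $\mathscr{U}_{2n}J$ is Hermitian; define $n\times n$ blocks $S,T,P$ (depending on $t,\lambda$) by $\widehat{Y}^*(t)\mathscr{U}_{2n}J\widehat{Y}(t)=2\begin{pmatrix} S & T \\ T^* & P \end{pmatrix}$. Under the definiteness condition there is a point $t_1=t_1(\lambda)\in[t_0,\infty)_{\mathbb{X}}$ such that $P(t,\lambda)>0$ for all $t\in[t_1,\infty)_{\mathbb{X}}$; fix such a $t_1(\lambda)$. For $t\ge t_1(\lambda)$ put $\mathscr{C}(t,\lambda)=-P^{-1}(t,\lambda)T^*(t,\lambda)$. *)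

theory Defs
  imports "HOL-Analysis.Analysis"
begin

section \<open>Time scales\<close>

definition time_scale :: "real set \<Rightarrow> bool" where
  "time_scale X \<longleftrightarrow> X \<noteq> {} \<and> closed X"

text \<open>
  The jump operators use the standard conventions inf {} = sup X and sup {} = inf X, so that a
  maximum (minimum) of the time scale is mapped to itself.
\<close>

definition fwd_jump :: "real set \<Rightarrow> real \<Rightarrow> real" where
  "fwd_jump X t = (if \<exists>s\<in>X. t < s then Inf {s \<in> X. t < s} else t)"

definition bwd_jump :: "real set \<Rightarrow> real \<Rightarrow> real" where
  "bwd_jump X t = (if \<exists>s\<in>X. s < t then Sup {s \<in> X. s < t} else t)"

definition graininess :: "real set \<Rightarrow> real \<Rightarrow> real" where
  "graininess X t = fwd_jump X t - t"

definition ts_ray :: "real set \<Rightarrow> real \<Rightarrow> real set" where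
  "ts_ray X a = X \<inter> {a..}"

text \<open>
  Functions given only on a ray of X are differentiated, and tested for rd-continuity, on that ray,
  which is a time scale in its own right; its forward jump is the one of X.
\<close>

lemma fwd_jump_ts_ray: "a \<le> t \<Longrightarrow> fwd_jump (ts_ray X a) t = fwd_jump X t"
proof -
  assume "a \<le> t"
  then have "{s \<in> ts_ray X a. t < s} = {s \<in> X. t < s}"
    by (auto simp: ts_ray_def)
  then show ?thesis
    unfolding fwd_jump_def by (metis (mono_tags, lifting) mem_Collect_eq)
qed

text \<open>
  The limit s \<longlongrightarrow> t runs over all s in X for which the quotient is defined. At a right-scattered
  point t the value s = t must be admitted (an isolated t has no other points nearby),
  hence the filter is not \<^term>\<open>at t within X\<close>.
\<close>

definition has_delta_derivative ::
    "real set \<Rightarrow> (real \<Rightarrow> 'a::real_normed_vector) \<Rightarrow> real \<Rightarrow> 'a \<Rightarrow> bool" where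
  "has_delta_derivative X y t D \<longleftrightarrow>
     ((\<lambda>s. (y (fwd_jump X t) - y s) /\<^sub>R (fwd_jump X t - s)) \<longlongrightarrow> D)
       (inf (nhds t) (principal (X - {fwd_jump X t})))"

definition rd_continuous_on :: "real set \<Rightarrow> (real \<Rightarrow> 'a::topological_space) \<Rightarrow> bool" where
  "rd_continuous_on X f \<longleftrightarrow>
     (\<forall>t\<in>X. (fwd_jump X t = t \<longrightarrow> continuous (at t within X) f) \<and>
            (bwd_jump X t = t \<longrightarrow> (\<exists>L. (f \<longlongrightarrow> L) (at t within (X \<inter> {..<t})))))"


section \<open>Complex matrices\<close>

definition adj :: "complex^'n^'m \<Rightarrow> complex^'m^'n" where
  "adj M = (\<chi> i j. cnj (M $ j $ i))"

definition cscale :: "complex \<Rightarrow> complex^'n^'m \<Rightarrow> complex^'n^'m" where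
  "cscale c M = (\<chi> i j. c * M $ i $ j)"

definition re_mat :: "complex^'n^'n \<Rightarrow> complex^'n^'n" where
  "re_mat M = (1/2) *\<^sub>R (M + adj M)"

definition hermitian :: "complex^'n^'n \<Rightarrow> bool" where
  "hermitian M \<longleftrightarrow> adj M = M"

definition quad_form :: "complex^'n^'n \<Rightarrow> complex^'n \<Rightarrow> complex" where
  "quad_form M x = (\<Sum>i\<in>UNIV. cnj (x $ i) * (M *v x) $ i)"

definition loewner_le :: "complex^'n^'n \<Rightarrow> complex^'n^'n \<Rightarrow> bool" where
  "loewner_le M N \<longleftrightarrow> hermitian (N - M) \<and> (\<forall>x. 0 \<le> Re (quad_form (N - M) x))"

definition loewner_less :: "complex^'n^'n \<Rightarrow> complex^'n^'n \<Rightarrow> bool" where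
  "loewner_less M N \<longleftrightarrow> hermitian (N - M) \<and> (\<forall>x. x \<noteq> 0 \<longrightarrow> 0 < Re (quad_form (N - M) x))"

text \<open>Matrices of order 2n are indexed by the sum type \<^typ>\<open>'n + 'n\<close>.\<close>

definition block :: "complex^'n^'n \<Rightarrow> complex^'n^'n \<Rightarrow> complex^'n^'n \<Rightarrow> complex^'n^'n
    \<Rightarrow> complex^('n::finite + 'n)^('n::finite + 'n)" where
  "block M11 M12 M21 M22 = (\<chi> i j.
     (case i of
        Inl p \<Rightarrow> (case j of Inl q \<Rightarrow> M11 $ p $ q | Inr q \<Rightarrow> M12 $ p $ q)
      | Inr p \<Rightarrow> (case j of Inl q \<Rightarrow> M21 $ p $ q | Inr q \<Rightarrow> M22 $ p $ q)))"

definition block12 :: "complex^('n::finite + 'n)^('n::finite + 'n) \<Rightarrow> complex^'n^'n" where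
  "block12 M = (\<chi> i j. M $ Inl i $ Inr j)"

definition block22 :: "complex^('n::finite + 'n)^('n::finite + 'n) \<Rightarrow> complex^'n^'n" where
  "block22 M = (\<chi> i j. M $ Inr i $ Inr j)"

definition left_cols :: "complex^('n::finite + 'n)^'m \<Rightarrow> complex^'n^'m" where
  "left_cols M = (\<chi> i j. M $ i $ Inl j)"

definition right_cols :: "complex^('n::finite + 'n)^'m \<Rightarrow> complex^'n^'m" where
  "right_cols M = (\<chi> i j. M $ i $ Inr j)"


section \<open>The Hamiltonian system\<close>

definition J_mat :: "complex^('n::finite + 'n)^('n::finite + 'n)" where
  "J_mat = block 0 (- mat 1) (mat 1) 0"

definition U2n :: "complex^'n^'n \<Rightarrow> complex^('n::finite + 'n)^('n::finite + 'n)" where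
  "U2n U = block U 0 0 (- adj U)"

text \<open>\<open>m\<close> is the graininess at the point where the remaining arguments are evaluated.\<close>

definition H_mat :: "real \<Rightarrow> complex \<Rightarrow> complex^'n^'n \<Rightarrow> complex^'n^'n \<Rightarrow> complex^'n^'n
    \<Rightarrow> complex^('n::finite + 'n)^('n::finite + 'n)" where
  "H_mat m lam A1 B1 B2 =
     (let E2 = matrix_inv (mat 1 + m *\<^sub>R B2)
      in block (mat 1) 0 (- (m *\<^sub>R (E2 ** (cscale lam A1 + B1)))) E2)"

definition W_mat :: "complex^'n^'n \<Rightarrow> (real \<Rightarrow> complex^('n::finite + 'n)^('n::finite + 'n))
    \<Rightarrow> (real \<Rightarrow> complex^('n::finite + 'n)^('n::finite + 'n)) \<Rightarrow> real \<Rightarrow> complex \<Rightarrow> complex^('n::finite + 'n)^('n::finite + 'n)" where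
  "W_mat U A B t lam = re_mat (U2n U ** (cscale lam (A t) + B t))"

definition Lambda_set :: "real set \<Rightarrow> real \<Rightarrow> complex^'n^'n
    \<Rightarrow> (real \<Rightarrow> complex^('n::finite + 'n)^('n::finite + 'n)) \<Rightarrow> complex \<Rightarrow> complex set" where
  "Lambda_set X t0 U A lam0 =
     {lam. \<exists>\<delta>>0. \<forall>t\<in>ts_ray X t0.
        loewner_le (\<delta> *\<^sub>R (U2n U ** A t ** adj (U2n U)))
                   (re_mat (cscale (lam - lam0) (U2n U ** A t)))}"

text \<open>
  \<open>Y\<close> solves J Y^Delta = (lambda A + B) H Y on the ray, with Y(t0) = J;
  here \<open>K t\<close> stands for (lambda A(t) + B(t)) H(t, lambda).
\<close>

definition is_fundamental_matrix :: "real set \<Rightarrow> real \<Rightarrow> (real \<Rightarrow> complex^('n::finite + 'n)^('n::finite + 'n))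
    \<Rightarrow> (real \<Rightarrow> complex^('n::finite + 'n)^('n::finite + 'n)) \<Rightarrow> bool" where
  "is_fundamental_matrix X t0 K Y \<longleftrightarrow>
     Y t0 = J_mat \<and>
     (\<forall>t\<in>ts_ray X t0. \<exists>D. has_delta_derivative (ts_ray X t0) Y t D \<and> J_mat ** D = K t ** Y t)"


section \<open>Weyl-Sims sets\<close>

text \<open>
  In this section \<open>Y\<close> is the value at (t, lambda) of the fundamental matrix; its left and right
  column halves are theta-hat and phi-hat.
\<close>

definition weyl_sims_set :: "complex^'n^'n \<Rightarrow> complex^('n::finite + 'n)^('n::finite + 'n) \<Rightarrow> (complex^'n^'n) set" where
  "weyl_sims_set U Y =
     {l. loewner_le (adj (left_cols Y + right_cols Y ** l) ** (U2n U ** J_mat)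
                      ** (left_cols Y + right_cols Y ** l)) 0}"

text \<open>
  The blocks T and P of Y* U2n J Y = 2 (S T; T* P). As U2n J is Hermitian, so is
  the left-hand side, and its lower left block is indeed 2 T*.
\<close>

definition T_block :: "complex^'n^'n \<Rightarrow> complex^('n::finite + 'n)^('n::finite + 'n) \<Rightarrow> complex^'n^'n" where
  "T_block U Y = (1/2) *\<^sub>R block12 (adj Y ** (U2n U ** J_mat) ** Y)"

definition P_block :: "complex^'n^'n \<Rightarrow> complex^('n::finite + 'n)^('n::finite + 'n) \<Rightarrow> complex^'n^'n" where
  "P_block U Y = (1/2) *\<^sub>R block22 (adj Y ** (U2n U ** J_mat) ** Y)"

definition weyl_center :: "complex^'n^'n \<Rightarrow> complex^('n::finite + 'n)^('n::finite + 'n) \<Rightarrow> complex^'n^'n" where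
  "weyl_center U Y = - (matrix_inv (P_block U Y) ** adj (T_block U Y))"

definition is_t1 :: "real set \<Rightarrow> real \<Rightarrow> complex^'n^'n \<Rightarrow> (real \<Rightarrow> complex^('n::finite + 'n)^('n::finite + 'n))
    \<Rightarrow> real \<Rightarrow> bool" where
  "is_t1 X t0 U Y t1 \<longleftrightarrow>
     t1 \<in> ts_ray X t0 \<and> (\<forall>t\<in>ts_ray X t1. loewner_less 0 (P_block U (Y t)))"

end

theory Submission
  imports Defs
begin

text \<open>
  Let Q(t) = Y* (U2n J) Y. The Lagrange identity gives Q^Delta = 2 (H Y)* W (H Y), and W is positive
  semidefinite for lambda in the set Lambda, so Q increases in the Loewner order and the sets D(t)
  are nested. If P were singular at all times, compactness of the unit sphere would give a common
  null vector, against the definiteness condition. Completing the square,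
  D(t) = {l. (l - C)* P (l - C) \<le> R}, where -R is a minimum of the form Q/2 and hence R decreases.
  Here R \<ge> 0, as D(t) contains the l for which the lower half of theta + phi l vanishes.
  Evaluating the monotone form at the later centre yields
  (C(t) - C(s))* P(s) (C(t) - C(s)) \<le> R(s) - R(t), so the centres converge.
\<close>

subsection \<open>The delta derivative\<close>

text \<open>Two shifts in time have to match. The second half of the unknown is taken one point
  back, so \<open>H\<close> is needed to return to y, and the product rule on a time scale evaluates
  one factor at sigma(t). The lower half of \<open>H u\<close> turns out to be the lower half of u
  at sigma(t); therefore all terms carrying the graininess cancel and the derivative of Q is exactly
  the W-form, at dense and scattered points alike. A matrix l belongs to D(t) iff Q(t) is
  nonpositive on the graph of l, the set of vectors (x, l x). Each comparison of two times thus
  amounts to evaluating Q on a suitable graph, and only the real part of the Hermitian form enters.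
  Convergence of the centres requires one coercivity constant for all times. Since P increases, the
  constant of P(t1) serves, and the trace of R, nonnegative and decreasing, controls the squared
  Frobenius distance of two centres.\<close>

lemma tendsto_nhds_principal_point:
  fixes g :: "'a::topological_space \<Rightarrow> 'b::t1_space"
  assumes "(g \<longlongrightarrow> L) (inf (nhds t) (principal S))" "t \<in> S"
  shows "g t = L"
proof (rule ccontr)
  assume "g t \<noteq> L"
  then have "\<forall>\<^sub>F s in inf (nhds t) (principal S). g s \<in> - {g t}"
    using topological_tendstoD[OF assms(1), of "- {g t}"] by auto
  then have "\<forall>\<^sub>F s in nhds t. s \<in> S \<longrightarrow> g s \<in> - {g t}"
    by (simp add: eventually_inf_principal)
  with eventually_nhds_x_imp_x assms(2) show False by fastforce
qed

lemma fwd_jump_ge: "t \<le> fwd_jump X t"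
  unfolding fwd_jump_def by (auto intro: cInf_greatest)

lemma fwd_jump_le: "s \<in> X \<Longrightarrow> t < s \<Longrightarrow> fwd_jump X t \<le> s"
  unfolding fwd_jump_def by (auto intro!: cInf_lower bdd_belowI[of _ t])

context
  fixes X :: "real set" and y :: "real \<Rightarrow> 'a::real_normed_vector" and t :: real and D :: 'a
  assumes deriv: "has_delta_derivative X y t D" and t: "t \<in> X"
begin

text \<open>At a right-scattered t the filter of the derivative admits the point s = t, so the limit
  \<open>D\<close> is forced to be the quotient there. Otherwise the jump has length 0.\<close>

lemma delta_derivative_step: "y (fwd_jump X t) = y t + (fwd_jump X t - t) *\<^sub>R D"
proof (cases "fwd_jump X t = t")
  case False
  with tendsto_nhds_principal_point[OF deriv[unfolded has_delta_derivative_def]] t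
  have "(y (fwd_jump X t) - y t) /\<^sub>R (fwd_jump X t - t) = D" by auto
  then have "y (fwd_jump X t) - y t = (fwd_jump X t - t) *\<^sub>R D"
    using False by auto
  then show ?thesis by (simp add: diff_eq_eq add.commute)
qed simp

text \<open>Solving the difference quotient for \<open>y s\<close> expresses it through convergent
  quantities, and the step formula identifies the limit as \<open>y t\<close>. Continuity along this
  filter is what the product rule uses.\<close>

lemma delta_derivative_tendsto:
  "(y \<longlongrightarrow> y t) (inf (nhds t) (principal (X - {fwd_jump X t})))" (is "(_ \<longlongrightarrow> _) ?F")
proof -
  let ?s = "fwd_jump X t"
  have "((\<lambda>s. s) \<longlongrightarrow> t) ?F"
    by (simp add: filterlim_def)
  then have "((\<lambda>s. y ?s - (?s - s) *\<^sub>R ((y ?s - y s) /\<^sub>R (?s - s))) \<longlongrightarrow> y ?s - (?s - t) *\<^sub>R D) ?F"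
    by (intro tendsto_intros deriv[unfolded has_delta_derivative_def])
  then show ?thesis
    by (rule Lim_transform_eventually[THEN tendsto_eq_rhs])
       (auto simp: eventually_inf_principal delta_derivative_step)
qed

end

text \<open>The filter is nontrivial: a right-dense t is a limit point of \<open>X\<close>, and a
  right-scattered t belongs to the set itself. The existence of a later point excludes an isolated
  maximum, where the filter would be trivial.\<close>

lemma delta_derivative_unique:
  assumes "has_delta_derivative X y t D" "has_delta_derivative X y t D'"
    and t: "t \<in> X" "\<exists>s\<in>X. t < s"
  shows "D = D'"
proof -
  have "inf (nhds t) (principal (X - {fwd_jump X t})) \<noteq> bot"
  proof (cases "fwd_jump X t = t")
    case True
    have "\<exists>s\<in>X. s \<noteq> t \<and> dist s t < e" if "e > 0" for e
    proof (rule ccontr)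
      assume *: "\<not> ?thesis"
      have "t + e \<le> Inf {s \<in> X. t < s}"
        using t(2) * by (intro cInf_greatest) (force simp: dist_real_def)+
      then show False using True t(2) that by (auto simp: fwd_jump_def)
    qed
    then have "t islimpt X" by (simp add: islimpt_approachable)
    then show ?thesis
      using True by (simp add: trivial_limit_within flip: at_within_def)
  next
    case False
    then show ?thesis
      using t(1) eventually_nhds_x_imp_x[of "\<lambda>s. s \<in> X - {fwd_jump X t} \<longrightarrow> False" t]
      by (auto simp: trivial_limit_def eventually_inf_principal)
  qed
  then show ?thesis
    using assms(1,2) tendsto_unique unfolding has_delta_derivative_def by blast
qed

lemma delta_derivative_bounded_linear:
  assumes "bounded_linear h" "has_delta_derivative X y t D"
  shows "has_delta_derivative X (\<lambda>s. h (y s)) t (h D)"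
proof -
  interpret bounded_linear h by fact
  show ?thesis
    using tendsto[OF assms(2)[unfolded has_delta_derivative_def]]
    unfolding has_delta_derivative_def by (simp add: diff scaleR)
qed

text \<open>The increment is split at \<open>h (y s) (z ?s)\<close>, with the second factor at the
  jump, so that the moving point s enters only through \<open>y s\<close> and the two quotients. The
  resulting asymmetric rule is the shape in which the Lagrange identity is stated.\<close>

lemma delta_derivative_bounded_bilinear:
  assumes "bounded_bilinear h" "has_delta_derivative X y t D" "has_delta_derivative X z t E" "t \<in> X"
  shows "has_delta_derivative X (\<lambda>s. h (y s) (z s)) t (h D (z (fwd_jump X t)) + h (y t) E)"
proof -
  interpret bounded_bilinear h by fact
  note lim = assms(2,3)[unfolded has_delta_derivative_def]
  let ?s = "fwd_jump X t"
  have eq: "(h (y ?s) (z ?s) - h (y s) (z s)) /\<^sub>R (?s - s) =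
      h ((y ?s - y s) /\<^sub>R (?s - s)) (z ?s) + h (y s) ((z ?s - z s) /\<^sub>R (?s - s))" for s
    by (simp add: scaleR_left scaleR_right diff_left diff_right algebra_simps flip: scaleR_right_distrib scaleR_diff_right)
  show ?thesis
    unfolding has_delta_derivative_def eq
    by (intro tendsto_add tendsto lim tendsto_const delta_derivative_tendsto[OF assms(2,4)])
qed

text \<open>
  The infimum of the points violating \<open>f s \<ge> f a - e * (s - a)\<close> can neither be left-dense nor
  left-scattered if it violates the inequality, nor right-dense or right-scattered if it does not.
\<close>

lemma delta_derivative_nonneg_imp_mono:
  fixes f :: "real \<Rightarrow> real"
  assumes X: "closed X" and deriv: "\<And>t. t \<in> X \<Longrightarrow> \<exists>D\<ge>0. has_delta_derivative X f t D"
    and ab: "a \<in> X" "b \<in> X" "a \<le> b"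
  shows "f a \<le> f b"
proof -
  have step: "f p \<le> f (fwd_jump X p)" if "p \<in> X" for p
    using deriv[OF that] delta_derivative_step[OF _ that] fwd_jump_ge[of p X] by force
  \<comment> \<open>A derivative equal to 0 gives no sign for nearby increments. The slack
    \<open>e\<close> makes the comparison of slopes strict and is sent to 0 at the end.\<close>
  have "f a - e * (b - a) \<le> f b" if e: "e > 0" for e
  proof (rule ccontr)
    define V where "V = {s \<in> X. a \<le> s \<and> f s < f a - e * (s - a)}"
    define m where "m = Inf V"
    assume "\<not> ?thesis"
    then have V: "b \<in> V" using ab by (auto simp: V_def)
    have bdd: "bdd_below V" by (auto simp: V_def intro!: bdd_belowI[of _ a])
    have m_clos: "m \<in> closure V"
      unfolding m_def using V bdd by (intro closure_contains_Inf) auto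
    then have mX: "m \<in> X"
      using X closure_minimal[of V X] by (auto simp: V_def)
    have am: "a \<le> m" unfolding m_def using V by (intro cInf_greatest) (auto simp: V_def)
    have before: "s \<notin> V" if "s < m" for s
      using that cInf_lower[OF _ bdd] by (force simp: m_def)
    obtain D where D: "D \<ge> 0" "has_delta_derivative X f m D" using deriv[OF mX] by blast
    show False
    proof (cases "m \<in> V")
      case True
      then have am': "a < m" using am by (cases "a = m") (auto simp: V_def)
      have fm: "f m < f a - e * (m - a)" using True by (auto simp: V_def)
      show False
      proof (cases "\<exists>d>0. \<forall>s\<in>X. m - d < s \<longrightarrow> m \<le> s")
        case True
        then obtain d where d: "d > 0" "\<And>s. s \<in> X \<Longrightarrow> m - d < s \<Longrightarrow> m \<le> s" by auto
        \<comment> \<open>\<open>p\<close> is the left neighbour of \<open>m\<close>, so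
          \<open>m\<close> is its forward jump. Since \<open>f\<close> does not decrease across a
          jump, a violation at \<open>m\<close> would already be one at \<open>p\<close>, below the
          infimum.\<close>
        define p where "p = Sup (X \<inter> {..<m})"
        have ne: "X \<inter> {..<m} \<noteq> {}" using am' ab by auto
        have bd: "bdd_above (X \<inter> {..<m})" by (auto intro!: bdd_aboveI[of _ m])
        have pm: "p \<le> m - d" unfolding p_def using ne d by (intro cSup_least) force+
        have "p \<in> closure (X \<inter> {..<m})" unfolding p_def by (intro closure_contains_Sup ne bd)
        then have pX: "p \<in> X" using X closure_minimal[of "X \<inter> {..<m}" X] by auto
        have p_max: "s \<le> p" if "s \<in> X" "s < m" for s
          unfolding p_def using that bd by (intro cSup_upper) auto
        have "fwd_jump X p = m"
        proof (rule antisym)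
          show "fwd_jump X p \<le> m" using pm d(1) mX by (intro fwd_jump_le) auto
          show "m \<le> fwd_jump X p"
          proof -
            have "p < m" using pm d(1) by simp
            moreover have "m \<le> s" if "s \<in> X" "p < s" for s
              using p_max[of s] that by force
            ultimately show ?thesis
              unfolding fwd_jump_def using mX by (auto intro!: cInf_greatest)
          qed
        qed
        then have "f p \<le> f m" using step[OF pX] by simp
        moreover have "f a - e * (p - a) \<le> f p"
          using before[of p] pm d(1) pX p_max[of a] ab am' by (auto simp: V_def)
        moreover have "e * (p - a) \<le> e * (m - a)" using pm d e by (intro mult_left_mono) auto
        ultimately show False using fm by linarith
      next
        case False
        \<comment> \<open>Here \<open>m\<close> is left-dense, and by continuity the strict
          violation at \<open>m\<close> spreads to points of \<open>X\<close> on its left.\<close>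
        let ?F = "inf (nhds m) (principal (X - {fwd_jump X m}))"
        have "((\<lambda>s. f a - e * (s - a) - f s) \<longlongrightarrow> f a - e * (m - a) - f m) ?F"
          by (intro tendsto_intros delta_derivative_tendsto[OF D(2) mX]) (simp add: filterlim_def)
        then have "\<forall>\<^sub>F s in ?F. 0 < f a - e * (s - a) - f s"
          using fm by (intro order_tendstoD(1)) auto
        then obtain d where d: "d > 0" "\<And>s. dist s m < d \<Longrightarrow> s \<in> X - {fwd_jump X m} \<Longrightarrow> f s < f a - e * (s - a)"
          unfolding eventually_inf_principal eventually_nhds_metric by auto
        obtain s where s: "s \<in> X" "m - min d (m - a) < s" "s < m"
          using False d(1) am' by (metis diff_gt_0_iff_gt min_less_iff_conj not_le)
        then have "s \<in> V" using d(2)[of s] fwd_jump_ge[of m X] by (auto simp: V_def dist_real_def)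
        with before s show False by blast
      qed
    next
      case False
      then have fm: "f a - e * (m - a) \<le> f m" using mX am by (auto simp: V_def)
      \<comment> \<open>As \<open>m\<close> is in the closure of \<open>V\<close> but not in
        \<open>V\<close>, violations accumulate at \<open>m\<close> from the right. This makes
        \<open>m\<close> right-dense, and the quotients near \<open>m\<close> eventually exceed
        \<open>- e\<close>, which no violating point allows.\<close>
      have near: "\<exists>s\<in>V. m < s \<and> s < m + d" if d: "d > 0" for d
      proof -
        obtain s where "s \<in> V" "dist s m < d" using m_clos d unfolding closure_approachable by blast
        then show ?thesis using before[of s] False
          by (intro bexI[of _ s]) (auto simp: dist_real_def, metis linorder_neqE_linordered_idom)
      qed
      have sm: "fwd_jump X m = m"
      proof (rule ccontr)
        assume "fwd_jump X m \<noteq> m"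
        then obtain s where "s \<in> V" "m < s" "s < fwd_jump X m"
          using near[of "fwd_jump X m - m"] fwd_jump_ge[of m X] by force
        then show False using fwd_jump_le[of s X m] by (auto simp: V_def)
      qed
      have "\<forall>\<^sub>F s in inf (nhds m) (principal (X - {m})). - e < (f m - f s) /\<^sub>R (m - s)"
        using order_tendstoD(1)[OF D(2)[unfolded has_delta_derivative_def sm], of "- e"] D(1) e by auto
      then obtain d where d: "d > 0"
        "\<And>s. dist s m < d \<Longrightarrow> s \<in> X - {m} \<Longrightarrow> - e < (f m - f s) /\<^sub>R (m - s)"
        unfolding eventually_inf_principal eventually_nhds_metric by auto
      obtain s where s: "s \<in> V" "m < s" "s < m + d" using near[OF d(1)] by blast
      then have "- e < (f m - f s) /\<^sub>R (m - s)"
        by (intro d(2)) (auto simp: V_def dist_real_def)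
      then have "- e * (s - m) < f s - f m"
        using s(2) by (simp add: field_simps)
      then show False using s(1) fm by (auto simp: V_def algebra_simps)
    qed
  qed
  then have lim: "\<forall>\<^sub>F e in at_right 0. f a - e * (b - a) \<le> f b"
    by (auto simp: eventually_at_filter)
  have "((\<lambda>e. f a - e * (b - a)) \<longlongrightarrow> f a - 0 * (b - a)) (at_right 0)"
    by (intro tendsto_intros)
  from tendsto_upperbound[OF this lim] show ?thesis by simp
qed

lemma fwd_jump_mem: "closed X \<Longrightarrow> t \<in> X \<Longrightarrow> fwd_jump X t \<in> X"
proof -
  assume X: "closed X" and t: "t \<in> X"
  have "Inf {s \<in> X. t < s} \<in> closure {s \<in> X. t < s}" if "\<exists>s\<in>X. t < s"
    using that by (intro closure_contains_Inf bdd_belowI[of _ t]) auto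
  then show ?thesis
    using t closure_minimal[of "{s \<in> X. t < s}" X] X by (auto simp: fwd_jump_def)
qed

text \<open>The quotient vanishes identically on the filter because the jump of t also lies in
  \<open>X\<close>. This is the way back from a constant form to a vanishing W-form.\<close>

lemma delta_derivative_const:
  assumes "closed X" "t \<in> X" "\<exists>s\<in>X. t < s"
    and const: "\<And>s. s \<in> X \<Longrightarrow> y s = c" and deriv: "has_delta_derivative X y t D"
  shows "D = 0"
proof (rule delta_derivative_unique[OF deriv _ assms(2,3)])
  have "((\<lambda>s. 0) \<longlongrightarrow> 0) (inf (nhds t) (principal (X - {fwd_jump X t})))" by simp
  then show "has_delta_derivative X y t 0"
    unfolding has_delta_derivative_def
    by (rule Lim_transform_eventually)
       (simp add: eventually_inf_principal const fwd_jump_mem assms(1,2))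
qed

subsection \<open>Nested families along a time scale\<close>

text \<open>\<open>f\<close> decreases and is bounded below, so its decrements are small on a tail;
  the bound turns this into a Cauchy condition for \<open>C\<close>.\<close>

lemma convergent_of_monotone_bound:
  fixes C :: "real \<Rightarrow> 'a::banach" and f :: "real \<Rightarrow> real"
  assumes X: "\<not> bdd_above X" and c: "c > 0"
    and bound: "\<And>s t. s \<in> ts_ray X a \<Longrightarrow> t \<in> ts_ray X a \<Longrightarrow> s \<le> t \<Longrightarrow> c * (norm (C t - C s))\<^sup>2 \<le> f s - f t"
    and f: "\<And>t. t \<in> ts_ray X a \<Longrightarrow> 0 \<le> f t"
  shows "\<exists>L. (C \<longlongrightarrow> L) (inf at_top (principal X))"
proof -
  have ray: "\<exists>t\<in>ts_ray X a. b \<le> t" for b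
  proof -
    obtain t where "t \<in> X" "max a b < t" using X by (meson bdd_above.I not_le)
    then show ?thesis by (intro bexI[of _ t]) (auto simp: ts_ray_def)
  qed
  have tail: "\<exists>s\<in>ts_ray X a. \<forall>t\<in>ts_ray X a. s \<le> t \<longrightarrow> norm (C t - C s) < e" if e: "e > 0" for e
  proof -
    \<comment> \<open>A remaining drop of \<open>f\<close> below \<open>c * e\<^sup>2\<close> is
      what the bound converts into a distance below \<open>e\<close>.\<close>
    have "Inf (f ` ts_ray X a) < Inf (f ` ts_ray X a) + c * e\<^sup>2" using c e by simp
    then obtain s where s: "s \<in> ts_ray X a" "f s < Inf (f ` ts_ray X a) + c * e\<^sup>2"
      using cInf_lessD[of "f ` ts_ray X a"] ray by blast
    have "norm (C t - C s) < e" if t: "t \<in> ts_ray X a" "s \<le> t" for t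
    proof -
      have "Inf (f ` ts_ray X a) \<le> f t"
        using t f by (intro cInf_lower) (auto intro!: bdd_belowI[of _ 0])
      then have "c * (norm (C t - C s))\<^sup>2 < c * e\<^sup>2" using bound[OF s(1) t] s(2) by linarith
      then show ?thesis using c e by (simp add: power_less_imp_less_base)
    qed
    with s show ?thesis by blast
  qed
  \<comment> \<open>Completeness is applied along one sequence tending to infinity in the ray; the
    tail estimate then carries its limit over to the whole filter.\<close>
  obtain x where x: "\<And>n. x n \<in> ts_ray X a" "\<And>n. real n \<le> x n"
    using bchoice[of "UNIV :: nat set" "\<lambda>n t. t \<in> ts_ray X a \<and> real n \<le> t"] ray by auto
  have x_ge: "\<exists>N. \<forall>n\<ge>N. s \<le> x n" for s
    using x(2) by (meson of_nat_le_iff order_trans real_arch_simple)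
  have "Cauchy (C \<circ> x)"
  proof (rule metric_CauchyI)
    fix e :: real assume "e > 0"
    then obtain s where s: "\<And>t. t \<in> ts_ray X a \<Longrightarrow> s \<le> t \<Longrightarrow> norm (C t - C s) < e / 2"
      using tail[of "e / 2"] by auto
    obtain N where "\<And>n. n \<ge> N \<Longrightarrow> s \<le> x n" using x_ge by blast
    then show "\<exists>M. \<forall>m\<ge>M. \<forall>n\<ge>M. dist ((C \<circ> x) m) ((C \<circ> x) n) < e"
      using s x(1) unfolding comp_def by (metis dist_norm dist_triangle_half_l)
  qed
  then obtain L where L: "(C \<circ> x) \<longlonglongrightarrow> L" by (metis Cauchy_convergent convergent_def)
  have "(C \<longlongrightarrow> L) (inf at_top (principal X))"
  proof (rule tendstoI)
    fix e :: real assume e: "e > 0"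
    then obtain s where s: "s \<in> ts_ray X a" "\<And>t. t \<in> ts_ray X a \<Longrightarrow> s \<le> t \<Longrightarrow> norm (C t - C s) < e / 2"
      using tail[of "e / 2"] by auto
    obtain N where N: "\<And>n. n \<ge> N \<Longrightarrow> s \<le> x n" using x_ge by blast
    have "\<forall>\<^sub>F n in sequentially. norm ((C \<circ> x) n - C s) \<le> e / 2"
      using N s(2) x(1) by (auto simp: eventually_sequentially intro!: exI[of _ N] less_imp_le)
    then have "norm (L - C s) \<le> e / 2"
      by (intro tendsto_upperbound[OF tendsto_norm[OF tendsto_diff[OF L tendsto_const]]]) auto
    then have "dist (C t) L < e" if "t \<in> X" "s \<le> t" for t
      using s(1) s(2)[of t] that norm_triangle_ineq4[of "C t - C s" "L - C s"]
      by (auto simp: ts_ray_def dist_norm)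
    then show "\<forall>\<^sub>F t in inf at_top (principal X). dist (C t) L < e"
      by (auto simp: eventually_inf_principal eventually_at_top_linorder)
  qed
  then show ?thesis ..
qed

text \<open>Each claim says that a limit as s tends to infinity stays in a closed set belonging to a
  fixed t. For \<open>m + C s\<close> the membership comes from nestedness of the sets, for
  \<open>l - C s\<close> from nestedness of their translates.\<close>

lemma nested_translated_limit:
  fixes D :: "real \<Rightarrow> 'a::real_normed_vector set"
  assumes X: "\<not> bdd_above X"
    and closed: "\<And>t. t \<in> ts_ray X a \<Longrightarrow> closed (D t)"
    and nested: "\<And>s t. s \<in> ts_ray X a \<Longrightarrow> t \<in> ts_ray X a \<Longrightarrow> s \<le> t \<Longrightarrow> D t \<subseteq> D s"
    and shifted: "\<And>s t. s \<in> ts_ray X a \<Longrightarrow> t \<in> ts_ray X a \<Longrightarrow> s \<le> t \<Longrightarrow>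
      (\<lambda>l. l - C t) ` D t \<subseteq> (\<lambda>l. l - C s) ` D s"
    and C: "\<And>t. t \<in> ts_ray X a \<Longrightarrow> C t \<in> D t"
    and L: "(C \<longlongrightarrow> L) (inf at_top (principal X))"
  shows "(\<Inter>t\<in>ts_ray X a. (\<lambda>l. l - C t) ` D t) = (\<lambda>l. l - L) ` (\<Inter>t\<in>ts_ray X a. D t)"
    and "L \<in> (\<Inter>t\<in>ts_ray X a. D t)"
proof -
  let ?F = "inf at_top (principal X)"
  have F: "?F \<noteq> bot"
    using X unfolding trivial_limit_def
    by (auto simp: eventually_inf_principal eventually_at_top_linorder) (meson bdd_above.I linear)
  have limit: "z \<in> S" if S: "closed S" and g: "(g \<longlongrightarrow> z) ?F" and t: "t \<in> ts_ray X a"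
    and mem: "\<And>s. s \<in> ts_ray X a \<Longrightarrow> t \<le> s \<Longrightarrow> g s \<in> S" for z S t and g :: "real \<Rightarrow> 'a"
  proof (rule Lim_in_closed_set[OF S _ F g])
    show "\<forall>\<^sub>F s in ?F. g s \<in> S"
      using mem t unfolding eventually_inf_principal eventually_at_top_linorder
      by (auto simp: ts_ray_def intro!: exI[of _ t])
  qed
  show "L \<in> (\<Inter>t\<in>ts_ray X a. D t)"
    using limit[OF closed L] C nested by blast
  show "(\<Inter>t\<in>ts_ray X a. (\<lambda>l. l - C t) ` D t) = (\<lambda>l. l - L) ` (\<Inter>t\<in>ts_ray X a. D t)"
  proof (intro equalityI subsetI)
    fix m assume m: "m \<in> (\<Inter>t\<in>ts_ray X a. (\<lambda>l. l - C t) ` D t)"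
    have "m + L \<in> D t" if t: "t \<in> ts_ray X a" for t
    proof (rule limit[OF closed[OF t] tendsto_add[OF tendsto_const L] t])
      fix s assume s: "s \<in> ts_ray X a" "t \<le> s"
      then obtain l where "l \<in> D s" "m = l - C s" using m by blast
      then show "m + C s \<in> D t" using nested[OF t s] by auto
    qed
    then show "m \<in> (\<lambda>l. l - L) ` (\<Inter>t\<in>ts_ray X a. D t)"
      by (intro image_eqI[of _ _ "m + L"]) auto
  next
    fix m assume "m \<in> (\<lambda>l. l - L) ` (\<Inter>t\<in>ts_ray X a. D t)"
    then obtain l where l: "m = l - L" "\<And>t. t \<in> ts_ray X a \<Longrightarrow> l \<in> D t" by auto
    have "l - L \<in> (\<lambda>l. l - C t) ` D t" if t: "t \<in> ts_ray X a" for t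
    proof (rule limit[OF _ tendsto_diff[OF tendsto_const L] t])
      show "closed ((\<lambda>l. l - C t) ` D t)"
        using closed_translation[OF closed[OF t], of "- C t"] by simp
      show "l - C s \<in> (\<lambda>l. l - C t) ` D t" if "s \<in> ts_ray X a" "t \<le> s" for s
        using shifted[OF t that] l(2) that by blast
    qed
    then show "m \<in> (\<Inter>t\<in>ts_ray X a. (\<lambda>l. l - C t) ` D t)" using l(1) by blast
  qed
qed

subsection \<open>Complex matrices and the real inner product\<close>

text \<open>
  On \<^typ>\<open>complex^'n\<close> the inner product of HOL-Analysis is real: it is the real part of the
  Hermitian form, so \<open>qf M x\<close> is the real part of x* M x, and \<^const>\<open>adj\<close> is the adjoint.
\<close>

definition qf :: "complex^'n^'n \<Rightarrow> complex^'n \<Rightarrow> real" where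
  "qf M x = x \<bullet> (M *v x)"

lemma inner_vec_Re: "x \<bullet> y = Re (\<Sum>i\<in>UNIV. cnj (x $ i) * y $ i)"
  by (simp add: inner_vec_def inner_complex_def)

lemma Re_quad_form: "Re (quad_form M x) = qf M x"
  by (simp add: quad_form_def qf_def inner_vec_Re)

lemma loewner_le_iff: "loewner_le M N \<longleftrightarrow> hermitian (N - M) \<and> (\<forall>x. 0 \<le> qf (N - M) x)"
  by (simp add: loewner_le_def Re_quad_form)

lemma loewner_less_iff:
  "loewner_less M N \<longleftrightarrow> hermitian (N - M) \<and> (\<forall>x. x \<noteq> 0 \<longrightarrow> 0 < qf (N - M) x)"
  by (simp add: loewner_less_def Re_quad_form)

lemma inner_adj: "(adj M *v x) \<bullet> y = x \<bullet> (M *v y)"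
proof -
  have "(\<Sum>i\<in>UNIV. cnj ((adj M *v x) $ i) * y $ i) =
      (\<Sum>i\<in>UNIV. \<Sum>j\<in>UNIV. cnj (x $ j) * M $ j $ i * y $ i)"
    by (simp add: adj_def matrix_vector_mult_def cnj_sum sum_distrib_left sum_distrib_right mult_ac)
  also have "\<dots> = (\<Sum>j\<in>UNIV. \<Sum>i\<in>UNIV. cnj (x $ j) * M $ j $ i * y $ i)"
    by (rule sum.swap)
  also have "\<dots> = (\<Sum>j\<in>UNIV. cnj (x $ j) * (M *v y) $ j)"
    by (simp add: matrix_vector_mult_def sum_distrib_left mult_ac)
  finally show ?thesis by (simp only: inner_vec_Re)
qed

lemma inner_adj_right: "x \<bullet> (adj M *v y) = (M *v x) \<bullet> y"
  by (metis inner_adj inner_commute)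

lemma adj_adj [simp]: "adj (adj M) = M"
  by (simp add: adj_def vec_eq_iff)

lemma adj_0 [simp]: "adj 0 = 0"
  by (simp add: adj_def vec_eq_iff)

lemma adj_add: "adj (M + N) = adj M + adj N"
  by (simp add: adj_def vec_eq_iff)

lemma adj_minus: "adj (- M) = - adj M"
  by (simp add: adj_def vec_eq_iff)

lemma adj_scaleR: "adj (c *\<^sub>R M) = c *\<^sub>R adj M"
  by (simp add: adj_def vec_eq_iff)

lemma adj_mult: "adj (M ** N) = adj N ** adj M"
  by (simp add: adj_def matrix_matrix_mult_def vec_eq_iff cnj_sum mult.commute)

lemma cscale_add_left: "cscale (a + b) M = cscale a M + cscale b M"
  by (simp add: cscale_def vec_eq_iff algebra_simps)

lemma mult_cscale: "M ** cscale c N = cscale c (M ** N)"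
  by (simp add: cscale_def matrix_matrix_mult_def vec_eq_iff sum_distrib_left mult_ac)

lemma matrix_vector_minus [simp]: "(- M) *v x = - (M *v (x::'a::ring_1^'n))" "M *v (- x) = - (M *v x)"
  by (simp_all add: matrix_vector_mult_def vec_eq_iff sum_negf)

lemma scaleR_matrix_vector: "(c *\<^sub>R M) *v x = c *\<^sub>R (M *v (x::'a::real_algebra_1^'n))"
  by (simp add: matrix_vector_mult_def vec_eq_iff scaleR_sum_right)

lemmas matrix_vector_scaleR = linear_scale[OF matrix_vector_mul_linear]

lemma bounded_linear_mult_vector: "bounded_linear (\<lambda>M. M *v (x::complex^'n))"
  by (intro linear_conv_bounded_linear[THEN iffD1] linearI)
     (simp_all add: scaleR_matrix_vector matrix_vector_mult_add_rdistrib)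

lemma qf_minus: "qf (- M) x = - qf M x"
  and qf_add: "qf (M + N) x = qf M x + qf N x"
  and qf_scaleR: "qf (c *\<^sub>R M) x = c * qf M x"
  by (simp_all add: qf_def scaleR_matrix_vector algebra_simps inner_simps)

lemma qf_congruence: "qf (adj Y ** M ** Y) x = qf M (Y *v x)"
  by (simp add: qf_def inner_adj_right flip: matrix_vector_mul_assoc)

lemma qf_re_mat: "qf (re_mat M) x = qf M x"
  by (simp add: re_mat_def qf_scaleR qf_add) (simp add: qf_def inner_adj_right inner_commute)

lemma hermitian_re_mat: "hermitian (re_mat M)"
  by (simp add: hermitian_def re_mat_def adj_scaleR adj_add add.commute)

lemma hermitian_inner: "hermitian M \<Longrightarrow> (M *v x) \<bullet> y = x \<bullet> (M *v y)"
  by (metis hermitian_def inner_adj)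

lemma qf_vector_add:
  "hermitian M \<Longrightarrow> qf M (x + y) = qf M x + 2 * (x \<bullet> (M *v y)) + qf M y"
  using hermitian_inner[of M x y]
  by (simp add: qf_def algebra_simps inner_simps inner_commute)

lemma qf_vector_scaleR: "qf M (c *\<^sub>R x) = c\<^sup>2 * qf M x"
  by (simp add: qf_def matrix_vector_scaleR power2_eq_square)

lemma qf_zero [simp]: "qf M 0 = 0"
  by (simp add: qf_def)

lemma continuous_qf: "continuous_on S (qf M)"
  unfolding qf_def
  by (intro continuous_on_inner continuous_on_id linear_continuous_on
      matrix_vector_mul_bounded_linear)

text \<open>On the line through x in direction \<open>w = M *v x\<close> the form is
  \<open>2 * s * N + s\<^sup>2 * k\<close> with N the squared norm of w. Its linear term would make
  it negative for small negative s unless N is 0.\<close>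

lemma psd_kernel:
  assumes M: "hermitian M" "\<And>x. 0 \<le> qf M x" and x: "qf M x = 0"
  shows "M *v x = 0"
proof -
  define w where "w = M *v x"
  define k where "k = qf M w"
  define N where "N = w \<bullet> w"
  have k: "k \<ge> 0" using M(2) by (simp add: k_def)
  have "0 \<le> qf M (x + s *\<^sub>R w)" for s by (rule M(2))
  then have "0 \<le> 2 * s * N + s\<^sup>2 * k" for s
    using hermitian_inner[OF M(1), of x w]
    by (simp add: qf_vector_add M(1) x qf_vector_scaleR k_def N_def matrix_vector_scaleR
        mult.assoc flip: w_def)
  \<comment> \<open>Adding 1 keeps the denominator positive when \<open>k\<close> is 0, and the
    value of the form becomes \<open>- (s\<^sup>2 * (2 + k))\<close>.\<close>
  define s where "s = - N / (1 + k)"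
  have N: "N = - s * (1 + k)" using k by (simp add: s_def)
  have "0 \<le> 2 * s * N + s\<^sup>2 * k" by fact
  also have "\<dots> = - (s\<^sup>2 * (2 + k))" by (simp add: N power2_eq_square algebra_simps)
  finally have "s = 0" using k by (simp add: mult_le_0_iff)
  then have "N = 0" by (simp add: N)
  then show ?thesis by (simp add: N_def flip: w_def)
qed

text \<open>The constant is the minimum of the form over the compact unit sphere, extended to all
  vectors by homogeneity.\<close>

lemma pos_def_coercive:
  assumes "loewner_less 0 P"
  shows "\<exists>c>0. \<forall>x. c * (x \<bullet> x) \<le> qf P x"
proof (cases "sphere 0 1 = ({} :: (complex^'a) set)")
  case True
  have "x = 0" for x :: "complex^'a"
  proof (rule ccontr)
    assume "x \<noteq> 0"
    then have "x /\<^sub>R norm x \<in> sphere 0 1" by simp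
    with True show False by blast
  qed
  then have "1 * (x \<bullet> x) \<le> qf P x" for x
    by (metis inner_zero_left mult_zero_right order_refl qf_zero)
  then show ?thesis by (intro exI[of _ 1]) simp
next
  case False
  obtain u where u: "u \<in> sphere 0 1" "\<And>x. x \<in> sphere 0 1 \<Longrightarrow> qf P u \<le> qf P x"
    using continuous_attains_inf[OF compact_sphere False continuous_qf] by blast
  have "qf P u * (x \<bullet> x) \<le> qf P x" for x
  proof (cases "x = 0")
    case False
    then have "qf P u \<le> qf P (x /\<^sub>R norm x)" by (intro u) simp
    then show ?thesis
      using False by (simp add: qf_vector_scaleR field_simps power2_norm_eq_inner)
  qed simp
  moreover have "qf P u > 0" using assms u(1) by (cases "u = 0") (auto simp: loewner_less_iff)
  ultimately show ?thesis by blast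
qed

lemma pos_def_invertible: "loewner_less 0 P \<Longrightarrow> invertible P"
  unfolding invertible_left_inverse matrix_left_invertible_ker
  by (force simp: loewner_less_iff qf_def)

lemma matrix_inner_columns:
  fixes M :: "complex^'n^'m"
  shows "M \<bullet> M = (\<Sum>j\<in>UNIV. (M *v axis j 1) \<bullet> (M *v axis j 1))"
proof -
  have "(M *v axis j 1) $ i = M $ i $ j" for i j
    by (simp add: matrix_vector_mult_def axis_def if_distrib cong: if_cong)
  then show ?thesis
    unfolding inner_vec_def by (subst sum.swap) simp
qed

subsection \<open>Block vectors\<close>

definition vjoin :: "complex^'n \<Rightarrow> complex^'n \<Rightarrow> complex^('n::finite + 'n)" where
  "vjoin x y = (\<chi> i. case i of Inl p \<Rightarrow> x $ p | Inr p \<Rightarrow> y $ p)"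

lemma sum_Plus_UNIV:
  "sum f (UNIV :: ('a::finite + 'b::finite) set) = (\<Sum>i\<in>UNIV. f (Inl i)) + (\<Sum>i\<in>UNIV. f (Inr i))"
  unfolding UNIV_Plus_UNIV[symmetric] by (subst sum.Plus) auto

lemma all_sum_type: "(\<forall>i. Q i) \<longleftrightarrow> (\<forall>i. Q (Inl i)) \<and> (\<forall>i. Q (Inr i))"
  by (metis sum.exhaust)

lemma vjoin_eq_iff [simp]: "vjoin a b = vjoin c d \<longleftrightarrow> a = c \<and> b = d"
  by (simp add: vjoin_def vec_eq_iff all_sum_type)

lemma vjoin_exhaust: obtains x y where "z = vjoin x y"
proof
  show "z = vjoin (\<chi> i. z $ Inl i) (\<chi> i. z $ Inr i)"
    by (simp add: vjoin_def vec_eq_iff all_sum_type)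
qed

lemma vjoin_add: "vjoin a b + vjoin c d = vjoin (a + c) (b + d)"
  and vjoin_scaleR: "r *\<^sub>R vjoin a b = vjoin (r *\<^sub>R a) (r *\<^sub>R b)"
  by (simp_all add: vjoin_def vec_eq_iff all_sum_type)

lemma inner_vjoin: "vjoin a b \<bullet> vjoin c d = a \<bullet> c + b \<bullet> d"
  by (simp add: vjoin_def inner_vec_def sum_Plus_UNIV)

lemma block_vjoin: "block K L M N *v vjoin x y = vjoin (K *v x + L *v y) (M *v x + N *v y)"
  by (simp add: vjoin_def block_def vec_eq_iff all_sum_type matrix_vector_mult_def sum_Plus_UNIV)

lemma block_add: "block K L M N + block K' L' M' N' = block (K + K') (L + L') (M + M') (N + N')"
  by (simp add: block_def vec_eq_iff all_sum_type)

lemma cscale_block: "cscale c (block K L M N) = block (cscale c K) (cscale c L) (cscale c M) (cscale c N)"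
  by (simp add: cscale_def block_def vec_eq_iff all_sum_type)

lemma cscale_0 [simp]: "cscale c 0 = 0"
  by (simp add: cscale_def vec_eq_iff)

lemma adj_block: "adj (block K L M N) = block (adj K) (adj M) (adj L) (adj N)"
  by (simp add: adj_def block_def vec_eq_iff all_sum_type)

lemma block_exhaust: obtains K M where "Z = block K (block12 Z) M (block22 Z)"
proof
  show "Z = block (\<chi> i j. Z $ Inl i $ Inl j) (block12 Z) (\<chi> i j. Z $ Inr i $ Inl j) (block22 Z)"
    by (simp add: block_def block12_def block22_def vec_eq_iff all_sum_type)
qed

lemma block_eq_iff: "block K L M N = block K' L' M' N' \<longleftrightarrow> K = K' \<and> L = L' \<and> M = M' \<and> N = N'"
  by (auto simp: block_def vec_eq_iff all_sum_type)

lemma hermitian_block_exhaust: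
  assumes "hermitian Z"
  obtains K where "Z = block K (block12 Z) (adj (block12 Z)) (block22 Z)" "hermitian (block22 Z)"
proof -
  obtain K M where Z: "Z = block K (block12 Z) M (block22 Z)" by (rule block_exhaust)
  have "adj (block K (block12 Z) M (block22 Z)) = block K (block12 Z) M (block22 Z)"
    using assms unfolding hermitian_def Z[symmetric] .
  then have "adj (block12 Z) = M" "adj (block22 Z) = block22 Z"
    by (auto simp: adj_block block_eq_iff)
  with that Z show thesis by (metis hermitian_def)
qed

lemma matrix_eq_iff_vjoin: "M = N \<longleftrightarrow> (\<forall>x y. M *v vjoin x y = N *v vjoin x y)"
  unfolding matrix_eq by (metis vjoin_exhaust)

lemma cols_vector: "left_cols Y *v x + right_cols Y *v y = Y *v vjoin x y"
  by (simp add: left_cols_def right_cols_def vjoin_def vec_eq_iff matrix_vector_mult_def sum_Plus_UNIV)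

subsection \<open>The Hamiltonian form\<close>

lemma J_vjoin: "J_mat *v vjoin x y = vjoin (- y) x"
  by (simp add: J_mat_def block_vjoin)

text \<open>With both diagonal blocks zero, a vector having one vanishing half is isotropic. This
  yields the value of the form at the initial time and a member of every D(t) with P(t) > 0.\<close>

lemma U2n_J: "U2n U ** J_mat = block 0 (- U) (- adj U) 0"
  by (simp add: matrix_eq_iff_vjoin J_vjoin U2n_def block_vjoin flip: matrix_vector_mul_assoc)

lemma hermitian_U2n_J: "hermitian (U2n U ** J_mat)"
  by (simp add: U2n_J hermitian_def adj_block adj_minus)

text \<open>The matrix Q of the overview. It keeps the factor 2 in front of the blocks S, T,
  P.\<close>

definition gram :: "complex^'n^'n \<Rightarrow> complex^('n::finite + 'n)^('n::finite + 'n)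
    \<Rightarrow> complex^('n::finite + 'n)^('n::finite + 'n)" where
  "gram U Y = adj Y ** (U2n U ** J_mat) ** Y"

lemma hermitian_gram: "hermitian (gram U Y)"
  using hermitian_U2n_J[of U] by (simp add: gram_def hermitian_def adj_mult matrix_mul_assoc)

lemma qf_gram: "qf (gram U Y) z = qf (U2n U ** J_mat) (Y *v z)"
  unfolding gram_def by (rule qf_congruence)

lemma qf_gram_right: "qf (gram U Y) (vjoin 0 y) = 2 * qf (P_block U Y) y"
proof -
  obtain S where S: "gram U Y = block S (block12 (gram U Y)) (adj (block12 (gram U Y))) (block22 (gram U Y))"
    by (rule hermitian_block_exhaust[OF hermitian_gram])
  show ?thesis
    unfolding P_block_def gram_def[symmetric]
    by (subst S) (simp add: qf_def block_vjoin inner_vjoin scaleR_matrix_vector)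
qed

lemma hermitian_P_block: "hermitian (P_block U Y)"
proof -
  have "hermitian (block22 (gram U Y))"
    by (rule hermitian_block_exhaust[OF hermitian_gram])
  then show ?thesis
    by (simp add: hermitian_def P_block_def adj_scaleR flip: gram_def)
qed

text \<open>The matrix theta + phi l sends x to \<open>Y *v vjoin x (l *v x)\<close>, so membership
  is nonpositivity of the form on the graph of l. Hence a larger form has a smaller set.\<close>

lemma weyl_sims_set_iff: "l \<in> weyl_sims_set U Y \<longleftrightarrow> (\<forall>x. qf (gram U Y) (vjoin x (l *v x)) \<le> 0)"
proof -
  let ?Z = "left_cols Y + right_cols Y ** l"
  let ?M = "adj ?Z ** (U2n U ** J_mat) ** ?Z"
  have "hermitian (0 - ?M)"
    using hermitian_U2n_J[of U] by (simp add: hermitian_def adj_mult adj_minus matrix_mul_assoc)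
  moreover have "?Z *v x = Y *v vjoin x (l *v x)" for x
    by (simp add: matrix_vector_mult_add_rdistrib cols_vector flip: matrix_vector_mul_assoc)
  ultimately show ?thesis
    by (simp add: weyl_sims_set_def loewner_le_iff qf_minus qf_congruence qf_gram)
qed

text \<open>The choice of \<open>l\<close> that annihilates the lower half of \<open>Y *v vjoin x (l *v x)\<close>.\<close>

lemma weyl_sims_set_nonempty:
  assumes "loewner_less 0 (P_block U Y)"
  shows "weyl_sims_set U Y \<noteq> {}"
proof -
  obtain K M where Y: "Y = block K (block12 Y) M (block22 Y)" by (rule block_exhaust)
  have isotropic: "qf (U2n U ** J_mat) (vjoin x 0) = 0" for x
    by (simp add: qf_def U2n_J block_vjoin inner_vjoin)
  \<comment> \<open>A null vector v of this block would make the lower half of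
    \<open>Y *v vjoin 0 v\<close> vanish, so \<open>vjoin 0 v\<close> would be isotropic for
    \<open>gram U Y\<close>, against positivity of P.\<close>
  have "invertible (block22 Y)"
    unfolding invertible_left_inverse matrix_left_invertible_ker
  proof (intro allI impI)
    fix v assume "block22 Y *v v = 0"
    then have "Y *v vjoin 0 v = vjoin (block12 Y *v v) 0"
      by (subst Y) (simp add: block_vjoin)
    then have "qf (gram U Y) (vjoin 0 v) = 0" by (simp add: qf_gram isotropic)
    then show "v = 0" using assms by (auto simp: qf_gram_right loewner_less_iff)
  qed
  then obtain N where N: "block22 Y ** N = mat 1" by (auto simp: invertible_right_inverse)
  have "Y *v vjoin x (- (N ** M) *v x) = vjoin (K *v x - block12 Y *v (N *v (M *v x))) 0" for x
    by (subst Y) (simp add: block_vjoin N matrix_vector_mul_assoc matrix_mul_assoc)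
  then have "- (N ** M) \<in> weyl_sims_set U Y"
    by (simp add: weyl_sims_set_iff qf_gram isotropic)
  then show ?thesis by blast
qed

text \<open>For positive definite P this is the quadratic form of
  \<open>T ** matrix_inv P ** adj T - S\<close>, the R of the overview. Written as a value of the
  form at the centre it can be compared at two times directly.\<close>

definition weyl_radius_form :: "complex^'n^'n \<Rightarrow> complex^('n::finite + 'n)^('n::finite + 'n) \<Rightarrow> complex^'n \<Rightarrow> real" where
  "weyl_radius_form U Y x = - qf (gram U Y) (vjoin x (weyl_center U Y *v x)) / 2"

text \<open>The centre solves \<open>P C = - adj T\<close>, so the lower half of Q applied to (x, C
  x) vanishes. A further displacement w of the lower half alone therefore meets no cross
  term.\<close>

lemma gram_complete_square:
  assumes "loewner_less 0 (P_block U Y)"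
  shows "qf (gram U Y) (vjoin x y) =
    2 * qf (P_block U Y) (y - weyl_center U Y *v x) - 2 * weyl_radius_form U Y x"
proof -
  let ?Q = "gram U Y" and ?P = "P_block U Y" and ?T = "T_block U Y" and ?C = "weyl_center U Y"
  define w where "w = y - ?C *v x"
  have PT: "block22 ?Q = 2 *\<^sub>R ?P" "block12 ?Q = 2 *\<^sub>R ?T"
    by (simp_all add: P_block_def T_block_def gram_def)
  obtain S where S: "?Q = block S (2 *\<^sub>R ?T) (2 *\<^sub>R adj ?T) (2 *\<^sub>R ?P)"
    using hermitian_block_exhaust[OF hermitian_gram[of U Y]] unfolding PT by (metis adj_scaleR)
  have "?P ** matrix_inv ?P = mat 1"
    using pos_def_invertible[OF assms] unfolding invertible_def matrix_inv_def
    by (metis (mono_tags, lifting) someI)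
  then have "?P *v (?C *v x) = - (adj ?T *v x)"
    by (simp add: weyl_center_def matrix_vector_mul_assoc matrix_mul_assoc)
  then have Qx: "?Q *v vjoin x (?C *v x) = vjoin (S *v x + 2 *\<^sub>R ?T *v (?C *v x)) 0"
    by (subst S) (simp add: block_vjoin scaleR_matrix_vector)
  have "vjoin x y = vjoin 0 w + vjoin x (?C *v x)" by (simp add: vjoin_add w_def)
  then have "qf ?Q (vjoin x y) = 2 * qf ?P w + qf ?Q (vjoin x (?C *v x))"
    by (simp add: qf_vector_add hermitian_gram qf_gram_right Qx inner_vjoin)
  then show ?thesis by (simp add: weyl_radius_form_def w_def)
qed

section \<open>Matrix discs centred at 0 and their geometry\<close>

definition matrix_disc :: "complex^'n^'n \<Rightarrow> (complex^'n \<Rightarrow> real) \<Rightarrow> (complex^'n^'n) set" where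
  "matrix_disc P r = {M. \<forall>x. qf P (M *v x) \<le> r x}"

lemma weyl_sims_set_disc:
  assumes "loewner_less 0 (P_block U Y)"
  shows "(\<lambda>l. l - weyl_center U Y) ` weyl_sims_set U Y = matrix_disc (P_block U Y) (weyl_radius_form U Y)"
    (is "(\<lambda>l. l - ?C) ` ?D = ?R")
proof -
  have "l \<in> ?D \<longleftrightarrow> l - ?C \<in> ?R" for l
    by (simp add: weyl_sims_set_iff gram_complete_square[OF assms] matrix_disc_def
        matrix_vector_mult_diff_rdistrib)
  note iff = this
  show ?thesis
  proof (intro equalityI subsetI)
    fix x assume "x \<in> ?R"
    then have "x + ?C \<in> ?D" by (simp only: iff add_diff_cancel_right')
    then show "x \<in> (\<lambda>l. l - ?C) ` ?D" by (rule rev_image_eqI) simp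
  qed (use iff in blast)
qed

text \<open>Any single member M of the translated set gives
  \<open>0 \<le> qf P (M *v x) \<le> R x\<close>, so nonemptiness suffices.\<close>

lemma weyl_radius_form_nonneg:
  assumes P: "loewner_less 0 (P_block U Y)"
  shows "0 \<le> weyl_radius_form U Y x"
proof -
  obtain M where "M \<in> matrix_disc (P_block U Y) (weyl_radius_form U Y)"
    using weyl_sims_set_nonempty[OF P] unfolding weyl_sims_set_disc[OF P, symmetric] by blast
  then have "qf (P_block U Y) (M *v x) \<le> weyl_radius_form U Y x"
    by (simp add: matrix_disc_def)
  moreover have "0 \<le> qf (P_block U Y) (M *v x)"
    using P by (cases "M *v x = 0") (auto simp: loewner_less_iff intro: less_imp_le)
  ultimately show ?thesis by linarith
qed

lemma closed_matrix_disc: "closed (matrix_disc P r)"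
proof -
  have "closed {M. qf P (M *v x) \<le> r x}" for x
    by (intro closed_Collect_le continuous_on_compose2[OF continuous_qf[of UNIV]]
        linear_continuous_on bounded_linear_mult_vector continuous_on_const) auto
  moreover have "matrix_disc P r = (\<Inter>x. {M. qf P (M *v x) \<le> r x})"
    by (auto simp: matrix_disc_def)
  ultimately show ?thesis by auto
qed

text \<open>A positive form is convex: for u + v = 1 the convexity defect at vectors a and b is
  \<open>u * v * qf P (a - b)\<close>. The bound \<open>r x\<close> is common to both
  matrices.\<close>

lemma convex_matrix_disc:
  assumes P: "loewner_less 0 P"
  shows "convex (matrix_disc P r)"
proof (rule convexI)
  fix M N u v
  assume MN: "M \<in> matrix_disc P r" "N \<in> matrix_disc P r" and uv: "0 \<le> u" "0 \<le> v" "u + v = (1::real)"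
  have herm: "hermitian P" and pos: "0 \<le> qf P z" for z
    using P by (cases "z = 0"; auto simp: loewner_less_iff less_imp_le)+
  have "qf P ((u *\<^sub>R M + v *\<^sub>R N) *v x) \<le> r x" for x
  proof -
    let ?a = "M *v x" and ?b = "N *v x"
    have "0 \<le> u * v * qf P (?a + (- 1) *\<^sub>R ?b)" using uv pos by simp
    also have "\<dots> = u * v * (qf P ?a + qf P ?b - 2 * (?a \<bullet> (P *v ?b)))"
      unfolding qf_vector_add[OF herm] qf_vector_scaleR by simp
    also have "\<dots> = u * qf P ?a + v * qf P ?b - qf P (u *\<^sub>R ?a + v *\<^sub>R ?b)"
    proof -
      have v: "v = 1 - u" using uv by simp
      show ?thesis
        unfolding qf_vector_add[OF herm] qf_vector_scaleR matrix_vector_scaleR inner_scaleR_left inner_scaleR_right v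
        by (simp add: power2_eq_square algebra_simps)
    qed
    finally have "qf P (u *\<^sub>R ?a + v *\<^sub>R ?b) \<le> u * qf P ?a + v * qf P ?b" by simp
    also have "\<dots> \<le> u * r x + v * r x"
      using MN uv by (intro add_mono mult_left_mono) (auto simp: matrix_disc_def)
    also have "\<dots> = r x" using uv by (simp flip: distrib_right)
    finally show ?thesis by (simp add: matrix_vector_mult_add_rdistrib scaleR_matrix_vector)
  qed
  then show "u *\<^sub>R M + v *\<^sub>R N \<in> matrix_disc P r" by (simp add: matrix_disc_def)
qed

text \<open>The bound is applied column by column: \<open>M \<bullet> M\<close> is the squared Frobenius norm.\<close>

lemma coercive_columns_bound:
  assumes c: "c > 0" "\<And>x. c * (x \<bullet> x) \<le> qf P x" and M: "\<And>x. qf P (M *v x) \<le> r x"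
  shows "c * (norm M)\<^sup>2 \<le> (\<Sum>j\<in>UNIV. r (axis j 1))"
  unfolding power2_norm_eq_inner matrix_inner_columns sum_distrib_left
  by (intro sum_mono order_trans[OF c(2) M])

lemma compact_matrix_disc:
  assumes P: "loewner_less 0 P"
  shows "compact (matrix_disc P r)"
proof -
  obtain c where c: "c > 0" "\<And>x. c * (x \<bullet> x) \<le> qf P x" using pos_def_coercive[OF P] by blast
  have "norm M \<le> sqrt ((\<Sum>j\<in>UNIV. r (axis j 1)) / c)" if "M \<in> matrix_disc P r" for M
    using coercive_columns_bound[OF c, of M r] that c(1)
    by (intro real_le_rsqrt) (simp add: matrix_disc_def field_simps)
  then show ?thesis
    unfolding compact_eq_bounded_closed by (auto intro: boundedI closed_matrix_disc)
qed

lemma weyl_sims_set_compact_convex: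
  assumes P: "loewner_less 0 (P_block U Y)"
  shows "compact (weyl_sims_set U Y)" "convex (weyl_sims_set U Y)"
proof -
  let ?R = "matrix_disc (P_block U Y) (weyl_radius_form U Y)"
  have "weyl_sims_set U Y = (+) (weyl_center U Y) ` ?R"
    unfolding weyl_sims_set_disc[OF P, symmetric] image_image by simp
  then show "compact (weyl_sims_set U Y)" "convex (weyl_sims_set U Y)"
    using compact_translation[OF compact_matrix_disc[OF P]] convex_translation[OF convex_matrix_disc[OF P]]
    by auto
qed

text \<open>At the centre the square vanishes, leaving minus twice the nonnegative radius
  form.\<close>

lemma weyl_center_mem:
  assumes "loewner_less 0 (P_block U Y)"
  shows "weyl_center U Y \<in> weyl_sims_set U Y"
  using weyl_radius_form_nonneg[OF assms]
  by (simp add: weyl_sims_set_iff gram_complete_square[OF assms])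

text \<open>Here \<open>d\<close> is the delta derivative of \<open>u\<close> and \<open>m\<close>
  the graininess, so \<open>u + m *\<^sub>R d\<close> is the value at the jump and the left-hand
  side is what the product rule produces.\<close>

lemma lagrange_identity:
  assumes inv: "invertible (mat 1 + m *\<^sub>R B2)"
    and M: "M = cscale z (block A1 0 0 A2) + block B1 B2 B3 B4"
    and d: "J_mat *v d = M *v (H_mat m z A1 B1 B2 *v u)"
  shows "d \<bullet> ((U2n U ** J_mat) *v (u + m *\<^sub>R d)) + u \<bullet> ((U2n U ** J_mat) *v d) =
    2 * qf (re_mat (U2n U ** M)) (H_mat m z A1 B1 B2 *v u)"
proof -
  define M1 where "M1 = cscale z A1 + B1"
  define M4 where "M4 = cscale z A2 + B4"
  define E where "E = matrix_inv (mat 1 + m *\<^sub>R B2)"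
  have "(mat 1 + m *\<^sub>R B2) ** E = mat 1"
    using inv unfolding E_def invertible_def matrix_inv_def
    by (metis (mono_tags, lifting) someI)
  then have E: "x = E *v x + m *\<^sub>R (B2 *v (E *v x))" for x
    by (metis matrix_vector_mul_assoc matrix_vector_mul_lid matrix_vector_mult_add_rdistrib scaleR_matrix_vector)
  obtain a b where u: "u = vjoin a b" by (rule vjoin_exhaust)
  obtain d1 d2 where d12: "d = vjoin d1 d2" by (rule vjoin_exhaust)
  define e where "e = E *v (b - m *\<^sub>R (M1 *v a))"
  have H: "H_mat m z A1 B1 B2 *v u = vjoin a e"
    by (simp add: H_mat_def Let_def u block_vjoin e_def flip: E_def M1_def)
      (simp add: scaleR_matrix_vector matrix_vector_scaleR algebra_simps flip: matrix_vector_mul_assoc)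
  have M': "M = block M1 B2 B3 M4"
    by (simp add: M cscale_block block_add M1_def M4_def)
  have d1: "d1 = B3 *v a + M4 *v e" and d2: "- d2 = M1 *v a + B2 *v e"
    using d unfolding H d12 M' by (simp_all add: J_vjoin block_vjoin)
  \<comment> \<open>This rewrites the definition of \<open>e\<close> as
    \<open>b + m *\<^sub>R d2 = e\<close>: the lower half of \<open>H u\<close> is the lower half of
    u at the jump. In the sum the two terms in \<open>m\<close>, both pairing \<open>d1\<close> with
    \<open>U *v d2\<close>, then cancel.\<close>
  have "b - m *\<^sub>R (M1 *v a) = e + m *\<^sub>R (B2 *v e)" unfolding e_def by (rule E)
  then have b: "b = e + m *\<^sub>R (- d2)" by (simp add: d2 algebra_simps)
  have "qf (re_mat (U2n U ** M)) (vjoin a e) = a \<bullet> (U *v (- d2)) + e \<bullet> (- adj U *v d1)"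
    unfolding qf_re_mat d1 d2
    by (simp add: qf_def M' block_vjoin U2n_def inner_vjoin flip: matrix_vector_mul_assoc)
  moreover have "u + m *\<^sub>R d = vjoin (a + m *\<^sub>R d1) e"
    by (simp add: u d12 b vjoin_add vjoin_scaleR)
  ultimately show ?thesis
    unfolding H by (simp add: u d12 b U2n_J block_vjoin inner_vjoin inner_adj_right matrix_vector_right_distrib
        matrix_vector_mult_diff_distrib matrix_vector_scaleR inner_add_left inner_add_right inner_diff_left
        inner_diff_right inner_commute[of d1] inner_commute[of a])
qed

subsection \<open>Monotonicity in time\<close>

context
  fixes U :: "complex^'n^'n" and Y Y' :: "complex^('n::finite + 'n)^('n::finite + 'n)"
  assumes gram_mono: "\<And>v. qf (gram U Y) v \<le> qf (gram U Y') v"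
begin

lemma weyl_sims_set_antimono: "weyl_sims_set U Y' \<subseteq> weyl_sims_set U Y"
  using gram_mono order_trans by (auto simp: weyl_sims_set_iff) blast

lemma P_block_mono: "qf (P_block U Y) x \<le> qf (P_block U Y') x"
  using gram_mono[of "vjoin 0 x"] by (simp add: qf_gram_right)

text \<open>Both forms are compared on the graph of the later centre, where the later square is 0
  and the earlier one is the displacement of the centre.\<close>

lemma weyl_center_diff_bound:
  assumes "loewner_less 0 (P_block U Y)" "loewner_less 0 (P_block U Y')"
  shows "qf (P_block U Y) ((weyl_center U Y' - weyl_center U Y) *v x)
    \<le> weyl_radius_form U Y x - weyl_radius_form U Y' x"
  using gram_mono[of "vjoin x (weyl_center U Y' *v x)"]
  by (simp add: gram_complete_square assms matrix_vector_mult_diff_rdistrib)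

text \<open>The translated disc shrinks for two reasons: its radius form decreases while P
  increases.\<close>

lemma weyl_shifted_antimono:
  assumes P: "loewner_less 0 (P_block U Y)" "loewner_less 0 (P_block U Y')"
  shows "(\<lambda>l. l - weyl_center U Y') ` weyl_sims_set U Y' \<subseteq> (\<lambda>l. l - weyl_center U Y) ` weyl_sims_set U Y"
proof -
  have "weyl_radius_form U Y' x \<le> weyl_radius_form U Y x" for x
  proof -
    have "0 \<le> qf (P_block U Y) v" for v
      using P(1) by (cases "v = 0") (auto simp: loewner_less_iff less_imp_le)
    then show ?thesis using weyl_center_diff_bound[OF P, of x] by (meson diff_ge_0_iff_ge order_trans)
  qed
  then show ?thesis
    unfolding weyl_sims_set_disc[OF P(1)] weyl_sims_set_disc[OF P(2)] matrix_disc_def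
    using P_block_mono by (fastforce intro: order_trans)
qed

end

section \<open>The form along solutions: its derivative, its sign, and common null
  directions\<close>

lemma gram_delta_derivative:
  assumes Y: "is_fundamental_matrix X t0
      (\<lambda>t. (cscale z (A t) + B t) ** H_mat (graininess X t) z (A1 t) (B1 t) (B2 t)) Y"
    and t: "t \<in> ts_ray X t0" and inv: "invertible (mat 1 + graininess X t *\<^sub>R B2 t)"
    and AB: "A t = block (A1 t) 0 0 (A2 t)" "B t = block (B1 t) (B2 t) (B3 t) (B4 t)"
  shows "has_delta_derivative (ts_ray X t0) (\<lambda>s. qf (gram U (Y s)) v) t
    (2 * qf (W_mat U A B t z) (H_mat (graininess X t) z (A1 t) (B1 t) (B2 t) *v (Y t *v v)))"
proof -
  let ?H = "H_mat (graininess X t) z (A1 t) (B1 t) (B2 t)" and ?M = "cscale z (A t) + B t"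
  obtain D where D: "has_delta_derivative (ts_ray X t0) Y t D" "J_mat ** D = ?M ** ?H ** Y t"
    using Y t unfolding is_fundamental_matrix_def by blast
  have "has_delta_derivative (ts_ray X t0) (\<lambda>s. Y s *v v) t (D *v v)"
    by (rule delta_derivative_bounded_linear[OF bounded_linear_mult_vector D(1)])
  note deriv = this
  \<comment> \<open>The product rule needs the value at the jump of the ray, which agrees with the
    jump of \<open>X\<close> from t0 on; the step formula brings it into the shape of the Lagrange
    identity.\<close>
  have sigma: "Y (fwd_jump (ts_ray X t0) t) *v v = Y t *v v + graininess X t *\<^sub>R (D *v v)"
    using delta_derivative_step[OF deriv t] fwd_jump_ts_ray[of t0 t X] t
    by (simp add: graininess_def) (simp add: ts_ray_def)
  have "J_mat *v (D *v v) = ?M *v (?H *v (Y t *v v))"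
    using D(2) by (simp add: matrix_vector_mul_assoc matrix_mul_assoc)
  note lagrange = lagrange_identity[OF inv refl[of "cscale z (block (A1 t) 0 0 (A2 t)) + block (B1 t) (B2 t) (B3 t) (B4 t)"]
      this[unfolded AB], of U]
  have "bounded_bilinear (\<lambda>x y. x \<bullet> ((U2n U ** J_mat) *v y))"
    by (rule bounded_bilinear.comp[OF bounded_bilinear_inner bounded_linear_ident matrix_vector_mul_bounded_linear])
  from delta_derivative_bounded_bilinear[OF this deriv deriv t]
  show ?thesis
    unfolding qf_gram by (simp add: sigma lagrange W_mat_def AB qf_def)
qed

text \<open>W at z is W at lam0 plus the real part of (z - lam0) U A. The first is nonnegative by
  admissibility, and the second dominates a positive multiple of the congruence of A by U, which is
  nonnegative with A.\<close>

lemma W_mat_psd: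
  assumes adm: "loewner_le 0 (W_mat U A B t lam0)" and A: "loewner_le 0 (A t)"
    and z: "z \<in> Lambda_set X t0 U A lam0" and t: "t \<in> ts_ray X t0"
  shows "0 \<le> qf (W_mat U A B t z) x"
proof -
  obtain d where d: "d > 0" "loewner_le (d *\<^sub>R (U2n U ** A t ** adj (U2n U))) (re_mat (cscale (z - lam0) (U2n U ** A t)))"
    using z t unfolding Lambda_set_def by auto
  have "cscale z (A t) = cscale lam0 (A t) + cscale (z - lam0) (A t)"
    unfolding cscale_add_left[symmetric] by simp
  then have "qf (W_mat U A B t z) x = qf (W_mat U A B t lam0) x + qf (cscale (z - lam0) (U2n U ** A t)) x"
    by (simp add: W_mat_def qf_re_mat matrix_add_ldistrib qf_add mult_cscale)
  moreover have "0 \<le> qf (W_mat U A B t lam0) x"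
    using adm by (simp add: loewner_le_iff)
  moreover have "d * qf (A t) (adj (U2n U) *v x) \<le> qf (cscale (z - lam0) (U2n U ** A t)) x"
  proof -
    let ?N = "U2n U ** A t ** adj (U2n U)" and ?M = "re_mat (cscale (z - lam0) (U2n U ** A t))"
    have "0 \<le> qf (?M + - (d *\<^sub>R ?N)) x" using d(2) by (simp add: loewner_le_iff)
    then show ?thesis
      unfolding qf_add qf_minus qf_scaleR qf_re_mat using qf_congruence[of "adj (U2n U)" "A t" x] by simp
  qed
  moreover have "0 \<le> qf (A t) (adj (U2n U) *v x)" using A by (simp add: loewner_le_iff)
  ultimately show ?thesis using d(1) by (smt (verit) mult_nonneg_nonneg)
qed

text \<open>The unit vectors with nonpositive form are closed subsets of the compact sphere that
  shrink as t grows, so a finite intersection contains the set at its largest time.\<close>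

lemma common_null_direction:
  fixes P :: "real \<Rightarrow> complex^'n^'n"
  assumes mono: "\<And>s t x. s \<in> R \<Longrightarrow> t \<in> R \<Longrightarrow> s \<le> t \<Longrightarrow> qf (P s) x \<le> qf (P t) x"
    and null: "\<And>t. t \<in> R \<Longrightarrow> \<exists>x. x \<noteq> 0 \<and> qf (P t) x \<le> 0" and R: "R \<noteq> {}"
  shows "\<exists>x. x \<noteq> 0 \<and> (\<forall>t\<in>R. qf (P t) x \<le> 0)"
proof -
  have "sphere 0 1 \<inter> (\<Inter>t\<in>R. {x. qf (P t) x \<le> 0}) \<noteq> {}"
  proof (rule compact_imp_fip_image[OF compact_sphere])
    show "closed {x. qf (P t) x \<le> 0}" for t
      by (intro closed_Collect_le continuous_qf continuous_on_const)
    fix I assume I: "finite I" "I \<subseteq> R"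
    obtain r where "r \<in> R" using R by blast
    \<comment> \<open>Inserting \<open>r\<close> covers an empty \<open>I\<close>.\<close>
    define m where "m = Max (insert r I)"
    have m: "m \<in> R" "\<And>t. t \<in> I \<Longrightarrow> t \<le> m"
      using I \<open>r \<in> R\<close> Max_in[of "insert r I"] by (auto simp: m_def)
    obtain x where x: "x \<noteq> 0" "qf (P m) x \<le> 0" using null[OF m(1)] by blast
    have "qf (P t) (x /\<^sub>R norm x) \<le> 0" if "t \<in> I" for t
      using mono[of t m x] that I m x by (auto simp: qf_vector_scaleR mult_le_0_iff)
    then have "x /\<^sub>R norm x \<in> sphere 0 1 \<inter> (\<Inter>t\<in>I. {x. qf (P t) x \<le> 0})"
      using x(1) by simp
    then show "sphere 0 1 \<inter> (\<Inter>t\<in>I. {x. qf (P t) x \<le> 0}) \<noteq> {}" by blast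
  qed
  then obtain x where "x \<in> sphere 0 1" "\<forall>t\<in>R. qf (P t) x \<le> 0" by blast
  moreover from this(1) have "x \<noteq> 0" by auto
  ultimately show ?thesis by blast
qed

theorem theorem3p3:
  fixes X :: "real set" and t0 :: real
    and A1 A2 B1 B2 B3 B4 :: "real \<Rightarrow> complex^'n^'n"
    and A B :: "real \<Rightarrow> complex^('n::finite + 'n)^('n::finite + 'n)"
    and U :: "complex^'n^'n" and lam0 lam :: complex
    and H Yhat :: "real \<Rightarrow> complex \<Rightarrow> complex^('n::finite + 'n)^('n::finite + 'n)"
    and \<phi> :: "real \<Rightarrow> complex \<Rightarrow> complex^'n^('n::finite + 'n)"
    and D :: "real \<Rightarrow> (complex^'n^'n) set"
    and C :: "real \<Rightarrow> complex^'n^'n"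
  assumes X: "time_scale X" "\<not> bdd_above X" "t0 \<in> X"
    and jumps: "\<And>t. t \<in> ts_ray X t0 \<Longrightarrow> fwd_jump X (bwd_jump X t) = t"
               "\<And>t. t \<in> ts_ray X t0 \<Longrightarrow> bwd_jump X (fwd_jump X t) = t"
    and A_def: "\<And>t. A t = block (A1 t) 0 0 (A2 t)"
    and B_def: "\<And>t. B t = block (B1 t) (B2 t) (B3 t) (B4 t)"
    and A_nonneg: "\<And>t. t \<in> ts_ray X t0 \<Longrightarrow> loewner_le 0 (A t)"
    and rd_A: "rd_continuous_on (ts_ray X t0) A1" "rd_continuous_on (ts_ray X t0) A2"
    and rd_B: "rd_continuous_on (ts_ray X t0) B1" "rd_continuous_on (ts_ray X t0) B2"
              "rd_continuous_on (ts_ray X t0) B3" "rd_continuous_on (ts_ray X t0) B4"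
    and regressive:
      "\<And>t. t \<in> ts_ray X t0 \<Longrightarrow> invertible (mat 1 + graininess X t *\<^sub>R B2 t)"
      "\<And>t. t \<in> ts_ray X t0 \<Longrightarrow> invertible (mat 1 + graininess X t *\<^sub>R B3 t)"
    and U: "invertible U"
    and H_def: "\<And>t z. H t z = H_mat (graininess X t) z (A1 t) (B1 t) (B2 t)"
    and Yhat: "\<And>z. is_fundamental_matrix X t0 (\<lambda>t. (cscale z (A t) + B t) ** H t z) (\<lambda>t. Yhat t z)"
    and phi_def: "\<And>t z. \<phi> t z = H t z ** right_cols (Yhat t z)"
    and admissible: "\<And>t. t \<in> ts_ray X t0 \<Longrightarrow> loewner_le 0 (W_mat U A B t lam0)"
    and definiteness: "\<And>z \<zeta>. z \<in> Lambda_set X t0 U A lam0 \<Longrightarrow>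
           (\<forall>t\<in>ts_ray X t0. (W_mat U A B t z ** \<phi> t z) *v \<zeta> = 0) \<Longrightarrow> \<zeta> = 0"
    and lambda: "lam \<in> Lambda_set X t0 U A lam0"
    and D_def: "\<And>t. D t = weyl_sims_set U (Yhat t lam)"
    and C_def: "\<And>t. C t = weyl_center U (Yhat t lam)"
  shows "(\<forall>\<tau>\<in>ts_ray X t0. \<forall>t\<in>ts_ray X t0. \<tau> < t \<longrightarrow> D t \<subseteq> D \<tau>) \<and>
    (\<exists>t1. is_t1 X t0 U (\<lambda>t. Yhat t lam) t1) \<and>
    (\<forall>t1. is_t1 X t0 U (\<lambda>t. Yhat t lam) t1 \<longrightarrow>
       (\<forall>\<tau>\<in>ts_ray X t1. \<forall>t\<in>ts_ray X t1. \<tau> < t \<longrightarrow>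
           (\<lambda>l. l - C t) ` D t \<subseteq> (\<lambda>l. l - C \<tau>) ` D \<tau>) \<and>
       (\<forall>t\<in>ts_ray X t1. compact (D t) \<and> convex (D t)) \<and>
       (\<exists>C_inf. (C \<longlongrightarrow> C_inf) (inf at_top (principal X)) \<and>
           (\<Inter>t\<in>ts_ray X t1. (\<lambda>l. l - C t) ` D t)
             = (\<lambda>l. l - C_inf) ` (\<Inter>t\<in>ts_ray X t1. D t) \<and>
           C_inf \<in> (\<Inter>t\<in>ts_ray X t1. D t)))"
proof -
  let ?R = "ts_ray X t0" and ?Y = "\<lambda>t. Yhat t lam"
  let ?q = "\<lambda>v s. qf (gram U (?Y s)) v"
  have closed: "closed ?R" using X(1) by (auto simp: time_scale_def ts_ray_def)
  have unbounded: "\<exists>s\<in>?R. t < s" for t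
  proof -
    obtain s where "s \<in> X" "max t0 t < s" using X(2) by (meson bdd_above.I not_le)
    then show ?thesis by (intro bexI[of _ s]) (auto simp: ts_ray_def)
  qed
  have W: "0 \<le> qf (W_mat U A B t lam) x" if "t \<in> ?R" for t x
    using that admissible A_nonneg lambda by (intro W_mat_psd) auto
  have deriv: "has_delta_derivative ?R (?q v) t (2 * qf (W_mat U A B t lam) (H t lam *v (?Y t *v v)))"
    if "t \<in> ?R" for t v
    unfolding H_def
    using that regressive(1) A_def B_def
    by (intro gram_delta_derivative[where Y = ?Y, OF Yhat[of lam, unfolded H_def]]) auto
  have mono: "?q v s \<le> ?q v t" if "s \<in> ?R" "t \<in> ?R" "s \<le> t" for s t v
  proof (rule delta_derivative_nonneg_imp_mono[OF closed _ that])
    fix t assume t: "t \<in> ?R"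
    show "\<exists>d\<ge>0. has_delta_derivative ?R (?q v) t d"
      using deriv[OF t, of v] W[OF t] by (meson mult_nonneg_nonneg zero_le_numeral)
  qed
  have t1_exists: "\<exists>t1. is_t1 X t0 U ?Y t1"
  proof (rule ccontr)
    assume no_t1: "\<not> ?thesis"
    have P_mono: "qf (P_block U (?Y s)) x \<le> qf (P_block U (?Y t)) x"
      if "s \<in> ?R" "t \<in> ?R" "s \<le> t" for s t x
      using that by (intro P_block_mono mono)
    \<comment> \<open>That t is no admissible t1 yields a bad vector only at some s \<ge> t; as P
      increases, the same vector is bad at t.\<close>
    have "\<exists>x. x \<noteq> 0 \<and> qf (P_block U (?Y t)) x \<le> 0" if t: "t \<in> ?R" for t
    proof -
      obtain s where s: "s \<in> ts_ray X t" "\<not> loewner_less 0 (P_block U (?Y s))"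
        using no_t1 t by (auto simp: is_t1_def)
      then obtain x where "x \<noteq> 0" "qf (P_block U (?Y s)) x \<le> 0"
        by (auto simp: loewner_less_iff hermitian_P_block not_less)
      moreover have "s \<in> ?R" "t \<le> s" using s t by (auto simp: ts_ray_def)
      ultimately show ?thesis using P_mono[OF t, of s x] by (intro exI[of _ x]) simp
    qed
    note null_at = this
    have t0: "t0 \<in> ?R" using X(3) by (simp add: ts_ray_def)
    have "\<exists>\<zeta>. \<zeta> \<noteq> 0 \<and> (\<forall>t\<in>?R. qf (P_block U (?Y t)) \<zeta> \<le> 0)"
      by (rule common_null_direction[OF P_mono null_at]) (use t0 in auto)
    then obtain \<zeta> where \<zeta>: "\<zeta> \<noteq> 0" "\<And>t. t \<in> ?R \<Longrightarrow> qf (P_block U (?Y t)) \<zeta> \<le> 0"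
      by blast
    \<comment> \<open>\<open>J_mat\<close> sends (0, \<zeta>) to (-\<zeta>, 0), which is isotropic.
      So the form at (0, \<zeta>) starts at 0, cannot decrease, and is nonpositive by the choice of
      \<zeta>: it is constantly 0.\<close>
    have "?Y t0 = J_mat" using Yhat by (simp add: is_fundamental_matrix_def)
    then have "?q (vjoin 0 \<zeta>) t0 = 0"
      unfolding qf_gram by (simp add: J_vjoin U2n_J qf_def block_vjoin inner_vjoin)
    then have null: "?q (vjoin 0 \<zeta>) t = 0" if "t \<in> ?R" for t
      using mono[OF t0 that, of "vjoin 0 \<zeta>"] \<zeta>(2)[OF that] that
      by (auto simp: qf_gram_right ts_ray_def)
    \<comment> \<open>The derivative of the constant form is 0, and a vanishing value of the
      semidefinite W-form means that W annihilates the vector, as the definiteness condition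
      requires.\<close>
    have "(W_mat U A B t lam ** \<phi> t lam) *v \<zeta> = 0" if t: "t \<in> ?R" for t
    proof -
      have "2 * qf (W_mat U A B t lam) (H t lam *v (?Y t *v vjoin 0 \<zeta>)) = 0"
        using delta_derivative_const[OF closed t unbounded null deriv[OF t]] .
      then have "W_mat U A B t lam *v (H t lam *v (?Y t *v vjoin 0 \<zeta>)) = 0"
        using W[OF t] by (intro psd_kernel) (auto simp: W_mat_def hermitian_re_mat)
      then show ?thesis
        using cols_vector[of "?Y t" 0 \<zeta>] by (simp add: phi_def flip: matrix_vector_mul_assoc)
    qed
    then have "\<zeta> = 0" by (intro definiteness[OF lambda]) simp
    with \<zeta>(1) show False by simp
  qed
  have after_t1: "(\<forall>\<tau>\<in>ts_ray X t1. \<forall>t\<in>ts_ray X t1. \<tau> < t \<longrightarrow>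
           (\<lambda>l. l - C t) ` D t \<subseteq> (\<lambda>l. l - C \<tau>) ` D \<tau>) \<and>
       (\<forall>t\<in>ts_ray X t1. compact (D t) \<and> convex (D t)) \<and>
       (\<exists>C_inf. (C \<longlongrightarrow> C_inf) (inf at_top (principal X)) \<and>
           (\<Inter>t\<in>ts_ray X t1. (\<lambda>l. l - C t) ` D t)
             = (\<lambda>l. l - C_inf) ` (\<Inter>t\<in>ts_ray X t1. D t) \<and>
           C_inf \<in> (\<Inter>t\<in>ts_ray X t1. D t))"
    if t1: "is_t1 X t0 U ?Y t1" for t1
  proof -
    let ?R1 = "ts_ray X t1" and ?P = "\<lambda>t. P_block U (?Y t)"
    let ?r = "\<lambda>t. weyl_radius_form U (?Y t)"
    have P: "loewner_less 0 (?P t)" if "t \<in> ?R1" for t using t1 that by (simp add: is_t1_def)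
    have R1: "t \<in> ?R" if "t \<in> ?R1" for t using t1 that by (auto simp: is_t1_def ts_ray_def)
    have t1_mem: "t1 \<in> ?R1" using t1 by (auto simp: is_t1_def ts_ray_def)
    have nested: "D t \<subseteq> D s" if "s \<in> ?R1" "t \<in> ?R1" "s \<le> t" for s t
      unfolding D_def using that R1 by (intro weyl_sims_set_antimono mono)
    have shifted: "(\<lambda>l. l - C t) ` D t \<subseteq> (\<lambda>l. l - C s) ` D s" if "s \<in> ?R1" "t \<in> ?R1" "s \<le> t" for s t
      unfolding D_def C_def using that R1 P by (intro weyl_shifted_antimono mono)
    have compact_convex: "compact (D t)" "convex (D t)" if "t \<in> ?R1" for t
      unfolding D_def using weyl_sims_set_compact_convex[OF P[OF that]] by auto
    \<comment> \<open>Taken at \<open>t1\<close>, the constant is valid at all later times because P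
      increases, so the distance of centres is controlled uniformly.\<close>
    obtain c where c: "c > 0" "\<And>x. c * (x \<bullet> x) \<le> qf (?P t1) x"
      using pos_def_coercive[OF P[OF t1_mem]] by blast
    have "\<exists>L. (C \<longlongrightarrow> L) (inf at_top (principal X))"
    proof (rule convergent_of_monotone_bound[OF X(2) c(1)])
      fix s t assume st: "s \<in> ?R1" "t \<in> ?R1" "s \<le> t"
      have "t1 \<le> s" using st(1) by (simp add: ts_ray_def)
      then have "qf (?P t1) x \<le> qf (?P s) x" for x
        using t1_mem st(1) by (intro P_block_mono mono R1)
      then have coercive: "c * (x \<bullet> x) \<le> qf (?P s) x" for x
        using c(2) order_trans by blast
      have "qf (?P s) ((C t - C s) *v x) \<le> ?r s x - ?r t x" for x
        unfolding C_def using st by (intro weyl_center_diff_bound mono P R1)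
      \<comment> \<open>The sum over the axis vectors is the trace of R, which serves as the
        nonnegative decreasing function of time.\<close>
      from coercive_columns_bound[OF c(1) coercive this]
      show "c * (norm (C t - C s))\<^sup>2 \<le> (\<Sum>j\<in>UNIV. ?r s (axis j 1)) - (\<Sum>j\<in>UNIV. ?r t (axis j 1))"
        by (simp add: sum_subtractf)
    qed (auto intro!: sum_nonneg weyl_radius_form_nonneg P)
    then obtain L where L: "(C \<longlongrightarrow> L) (inf at_top (principal X))" ..
    have C_mem: "C t \<in> D t" if "t \<in> ?R1" for t
      unfolding C_def D_def by (rule weyl_center_mem[OF P[OF that]])
    have "closed (D t)" if "t \<in> ?R1" for t
      using compact_convex(1)[OF that] by (rule compact_imp_closed)
    note limit = nested_translated_limit[OF X(2) this nested shifted C_mem L]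
    show ?thesis
    proof (intro conjI exI[of _ L] L limit ballI impI)
      show "(\<lambda>l. l - C t) ` D t \<subseteq> (\<lambda>l. l - C \<tau>) ` D \<tau>"
        if "\<tau> \<in> ?R1" "t \<in> ?R1" "\<tau> < t" for \<tau> t
        using that by (intro shifted) auto
    qed (use compact_convex in auto)
  qed
  have "D t \<subseteq> D \<tau>" if "\<tau> \<in> ?R" "t \<in> ?R" "\<tau> < t" for \<tau> t
    unfolding D_def using that by (intro weyl_sims_set_antimono mono) auto
  with t1_exists after_t1 show ?thesis by (intro conjI allI ballI impI) auto
qed

end
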